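(* Let $P = a_0 u a_1 \cdots u a_k$ be a Dyck prefix, where $k\ge 0$ and $a_i\in\mathcal{D}$ for $0\le i\le k$. Then $$ f(d u P) = \sum \Big(\prod_{i=0}^{k} \mathrm{v}(a_i,s_i)\Big)\, J(s_0 V_1), $$ where the sum is taken over all sequences $(s_i)_{0\le i\le k}$ of Dyck paths with $|s_i|=|a_i|$ and $s_i\ge a_i$ for $0\le i\le k$, and over all sequences $(V_i)_{1\le i\le k+1}$ of Dyck prefixes with $V_{k+1}=\varepsilon$ and $V_i\ge u s_i V_{i+1}$ (in particular $|V_i|=|u s_i V_{i+1}|$) for $1\le i\le k$.
   Context: A (binary) path of length $n$ is a lattice path $P=p_1\cdots p_n$ starting at the origin, each step being an upstep $u=(1,1)$ or a downstep $d=(1,-1)$; $|P|=n$ is its length, $\varepsilon$ the empty path, $\mathcal{P}_n$ the set of paths of length $n$, $\mathcal{P}=\bigcup_{n\ge0}\mathcal{P}_n$, and $[h]=\{1,\dots,h\}$. Juxtaposition denotes concatenation. The height of a point of $P$ is its $y$-coordinate. $\mathcal{P}_n$ is ordered by $P\le Q$ iff $P$ lies weakly below $Q$ (at each abscissa the height of $P$ is at most that of $Q$); its maximum is $\mathbf{1}_n=u^n$. $[P,Q]$ denotes the set of paths $R$ with $P\le R\le Q$. A valley of $P$ is the last point of a maximal run of $d$'s: it is either the middle point of an occurrence of $du$, or the endpoint of $P$ when $P$ ends with $d$. Turning a valley into a peak means replacing the corresponding $du$ by $ud$ (or, for a valley at the end of the path, the final $d$ by $u$). The filling of $P$ is the path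 $\widetilde P$ obtained by turning every valley of $P$ into a peak (so $\widetilde{\mathbf 1_n}=\mathbf 1_n$). Put $P^{(0)}=P$, $P^{(i)}=\widetilde{P^{(i-1)}}$; the degree $\delta(P)$ is the least $k\ge0$ with $P^{(k)}=\mathbf 1_{|P|}$. A chain $P_0\le P_1\le\cdots\le P_k$ (of length $k$) has small intervals if for each $i\in[k]$ the path $P_i$ is obtained from $P_{i-1}$ by turning some valleys of $P_{i-1}$ into peaks (equivalently $P_{i-1}\le P_i\le\widetilde{P_{i-1}}$). $f(P)$ is the number of chains of length $\delta(P)$ with small intervals from $P$ to $\mathbf 1_{|P|}$. A Dyck path is a path that ends at height $0$ and never goes below height $0$; $\mathcal{D}$ is the set of Dyck paths (including $\varepsilon$). A Dyck prefix is a prefix of a Dyck path; every Dyck prefix can be written uniquely as $a_0ua_1\cdots ua_k$ with $k\ge0$, $a_i\in\mathcal D$. $J(P)=|[P,u^{|P|}]|$ for $P\in\mathcal P$. For a nonempty Dyck path $\sigma$, $\mathrm{hv}(\sigma)$ is the height of its highest valley (the endpoint of $\sigma$ counts as a valley). A multichain of Dyck paths $\sigma_0\le\sigma_1\le\cdots\le\sigma_h$ (all of the same length), with $h=\mathrm{hv}(\sigma_0)$, is of type $\mathrm v$ if for every $j\in[h]$ the paths $\sigma_j$ and $\sigma_{j-1}$ have the same valleys (as points of the plane) at every height at most $h-j$. For Dyck paths $a\le s$, $\mathrm v(a,s)$ is the number of multichains of type $\mathrm v$ with $\sigma_0=a$ and $\sigma_h=s$; by convention $\mathrm v(\varepsilon,\varepsilon)=1$.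 *)

theory Defs
  imports Main "HOL-Library.FuncSet"
begin

datatype step = U | D

type_synonym path = "step list"

fun rise :: "step \<Rightarrow> int" where
  "rise U = 1"
| "rise D = - 1"

definition height :: "path \<Rightarrow> nat \<Rightarrow> int" where
  "height P j = (\<Sum>x\<leftarrow>take j P. rise x)"

definition path_le :: "path \<Rightarrow> path \<Rightarrow> bool" (infix "\<preceq>" 50) where
  "P \<preceq> Q \<longleftrightarrow> length P = length Q \<and> (\<forall>j\<le>length P. height P j \<le> height Q j)"

definition path_top :: "nat \<Rightarrow> path" where
  "path_top n = replicate n U"

definition path_interval :: "path \<Rightarrow> path \<Rightarrow> path set" where
  "path_interval P Q = {R. P \<preceq> R \<and> R \<preceq> Q}"

text \<open>
  A valley is identified by its abscissa: the point between the steps \<open>P ! (j - 1)\<close> and \<open>P ! j\<close>.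
\<close>

definition valleys :: "path \<Rightarrow> nat set" where
  "valleys P = {j. 1 \<le> j \<and> j \<le> length P \<and> P ! (j - 1) = D \<and> (j = length P \<or> P ! j = U)}"

definition valley_points :: "path \<Rightarrow> (nat \<times> int) set" where
  "valley_points P = (\<lambda>j. (j, height P j)) ` valleys P"

text \<open>
  For \<open>S \<subseteq> valleys P\<close>, the path \<open>turn S P\<close> has every valley in \<open>S\<close> turned into a peak: at \<open>j \<in> S\<close>
  the step before the valley becomes \<open>U\<close> and the step after it, if there is one, becomes \<open>D\<close>.
  No two valleys are at adjacent abscissae, so these replacements do not interfere.
\<close>

definition turn :: "nat set \<Rightarrow> path \<Rightarrow> path" where
  "turn S P = map (\<lambda>i. if i + 1 \<in> S then U else if i \<in> S then D else P ! i) [0..<length P]"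

definition filling :: "path \<Rightarrow> path" where
  "filling P = turn (valleys P) P"

definition degree :: "path \<Rightarrow> nat" where
  "degree P = (LEAST k. (filling ^^ k) P = path_top (length P))"

text \<open>A chain of length \<open>k\<close> is the list of its \<open>k + 1\<close> members; repetitions are allowed.\<close>

definition small_intervals :: "path list \<Rightarrow> bool" where
  "small_intervals c \<longleftrightarrow> successively (\<lambda>P Q. P \<preceq> Q \<and> (\<exists>S\<subseteq>valleys P. Q = turn S P)) c"

definition num_small_chains :: "path \<Rightarrow> nat" where
  "num_small_chains P =
    card {c. length c = degree P + 1 \<and> hd c = P \<and> last c = path_top (length P) \<and> small_intervals c}"

definition dyck :: "path \<Rightarrow> bool" where
  "dyck P \<longleftrightarrow> height P (length P) = 0 \<and> (\<forall>j\<le>length P. 0 \<le> height P j)"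

definition dyck_prefix :: "path \<Rightarrow> bool" where
  "dyck_prefix P \<longleftrightarrow> (\<exists>Q. dyck (P @ Q))"

definition J :: "path \<Rightarrow> nat" where
  "J P = card (path_interval P (path_top (length P)))"

text \<open>Meaningful only for nonempty Dyck paths, whose valleys have nonnegative height.\<close>

definition hv :: "path \<Rightarrow> nat" where
  "hv P = nat (Max (height P ` valleys P))"

definition type_v :: "path list \<Rightarrow> bool" where
  "type_v c \<longleftrightarrow>
    (let h = hv (hd c) in
      length c = h + 1 \<and> (\<forall>P\<in>set c. dyck P) \<and> successively (\<preceq>) c \<and>
      (\<forall>j\<in>{1..h}. {p \<in> valley_points (c ! j). snd p \<le> int h - int j} =
                  {p \<in> valley_points (c ! (j - 1)). snd p \<le> int h - int j}))"

definition num_v :: "path \<Rightarrow> path \<Rightarrow> nat" where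
  "num_v a s = (if a = [] \<and> s = [] then 1 else card {c. type_v c \<and> hd c = a \<and> last c = s})"

end

(* A chain from duP to the top that has the minimal length fills every box between the two paths
   at a time bounded by the height of the box.  Recording how much earlier than this deadline each
   box is filled turns the chain into a multichain q 0 >= q 1 >= ... >= P in which q i agrees
   with P at all points of height < i.  The path q 0 is unconstrained and contributes the factor J.
   The rest starts with some q 1; since q 1, q 2, ... all return to height 0 at the end of a_0,
   each splits there.  The left parts, read backwards, form a multichain of type v, the right part
   of q 1 is V_1, and the right parts of q 2, q 3, ... (without their first step u) are again
   such a multichain, for the Dyck prefix a_1 u a_2 ... u a_k. *)

theory Submission imports Defs begin

text \<open>In a small interval a box can be filled only if the boxes supporting it from below left
  and below right are already filled. Filling times therefore grow strictly along upward diagonals.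
  From every box such diagonals climb to the last box at the end of the path, whose upper height
  equals the length of the chain; hence a box of upper height y is filled by time y. Subtracting the
  filling time from y turns "strictly later upwards" into "slack weakly decreasing upwards". This
  says exactly that, for each i, the boxes of slack greater than i fill the region between P and
  some path q i. A factor u raises the rest of the path by one and so lowers its pinning level by
  one. Shifting the index by one restores the original situation and leaves over one path that is
  bounded only from below; each V_i arises in this way.\<close>

section \<open>Upstep counts as coordinates of paths\<close>

definition ups :: "path \<Rightarrow> nat \<Rightarrow> nat" where
  "ups P j = count_list (take j P) U"

lemma ups_0 [simp]: "ups P 0 = 0"
  by (simp add: ups_def)

lemma ups_Suc: "j < length P \<Longrightarrow> ups P (Suc j) = ups P j + (if P ! j = U then 1 else 0)"
  by (simp add: ups_def take_Suc_conv_app_nth)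

lemma height_0 [simp]: "height P 0 = 0"
  by (simp add: height_def)

lemma height_Suc: "j < length P \<Longrightarrow> height P (Suc j) = height P j + rise (P ! j)"
  by (simp add: height_def take_Suc_conv_app_nth)

text \<open>Heights at a fixed abscissa all have the same parity. Upstep counts remove this
  constraint and change by 0 or 1 per step, so the order and the boxes become plain inequalities of
  natural numbers.\<close>

lemma height_ups: "j \<le> length P \<Longrightarrow> height P j = 2 * int (ups P j) - int j"
proof (induction j)
  case (Suc j)
  then show ?case by (cases "P ! j") (auto simp: height_Suc ups_Suc)
qed simp

lemma ups_Suc_bounds:
  assumes "j < length P"
  shows "ups P j \<le> ups P (Suc j)" "ups P (Suc j) \<le> Suc (ups P j)"
  using assms by (auto simp: ups_Suc)

lemma ups_le: "j \<le> length P \<Longrightarrow> ups P j \<le> j"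
  by (induction j) (auto simp: ups_Suc)

lemma ups_path_top: "j \<le> n \<Longrightarrow> ups (path_top n) j = j"
  by (induction j) (auto simp: ups_Suc path_top_def)

lemma path_le_iff_ups:
  "P \<preceq> Q \<longleftrightarrow> length P = length Q \<and> (\<forall>j\<le>length P. ups P j \<le> ups Q j)"
  by (auto simp: path_le_def height_ups)

lemma path_eqI_ups:
  assumes len: "length P = length Q" and eq: "\<And>j. j \<le> length P \<Longrightarrow> ups P j = ups Q j"
  shows "P = Q"
proof (rule nth_equalityI[OF len])
  fix j assume j: "j < length P"
  have "ups P (Suc j) = ups Q (Suc j)" "ups P j = ups Q j"
    using eq j by auto
  then show "P ! j = Q ! j"
    using ups_Suc[of j P] ups_Suc[of j Q] j len
    by (cases "P ! j"; cases "Q ! j") auto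
qed

lemma path_of_ups:
  assumes "u 0 = 0" "\<And>j. j < n \<Longrightarrow> u (Suc j) = u j \<or> u (Suc j) = Suc (u j)"
  obtains p where "length p = n" "\<And>j. j \<le> n \<Longrightarrow> ups p j = u j"
proof
  let ?p = "map (\<lambda>j. if u (Suc j) = u j then D else U) [0..<n]"
  show "length ?p = n" by simp
  show "ups ?p j = u j" if "j \<le> n" for j
    using that
  proof (induction j)
    case (Suc j)
    then show ?case using assms(2)[of j] by (auto simp: ups_Suc)
  qed (simp add: assms(1))
qed

text \<open>\<open>A\<close> is the set of boxes below a path to be built: \<open>left\<close>
  allows at most one upstep per abscissa and \<open>right\<close> forbids the count to drop. Both
  directions of the correspondence between chains and multichains build their paths from such a
  region.\<close>

lemma path_of_region:
  assumes zero: "\<And>j. j \<le> n \<Longrightarrow> A j 0"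
    and bound: "\<And>j m. j \<le> n \<Longrightarrow> A j m \<Longrightarrow> m \<le> j"
    and down: "\<And>j m. j \<le> n \<Longrightarrow> A j (Suc m) \<Longrightarrow> A j m"
    and left: "\<And>j m. j < n \<Longrightarrow> A (Suc j) (Suc m) \<Longrightarrow> A j m"
    and right: "\<And>j m. j < n \<Longrightarrow> A j m \<Longrightarrow> A (Suc j) m"
  shows "\<exists>p. length p = n \<and> (\<forall>j\<le>n. \<forall>m. m \<le> ups p j \<longleftrightarrow> A j m)"
proof -
  define u where "u j = Max {m. A j m}" for j
  have u: "m \<le> u j \<longleftrightarrow> A j m" if j: "j \<le> n" for j m
  proof -
    have fin: "finite {m. A j m}"
      using bound[OF j] by (auto intro: finite_subset[of _ "{..j}"])
    have "A j (u j)"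
      unfolding u_def using Max_in[OF fin] zero[OF j] by auto
    moreover have "A j a" if "a \<le> b" "A j b" for a b
      using that by (induction rule: dec_induct) (auto dest: down[OF j])
    ultimately show ?thesis
      unfolding u_def using Max_ge[OF fin] by (auto simp: u_def[symmetric])
  qed
  have "u 0 = 0"
    using u[of 0 "u 0"] bound[of 0] by auto
  moreover have "u (Suc j) = u j \<or> u (Suc j) = Suc (u j)" if "j < n" for j
  proof -
    have "u j \<le> u (Suc j)"
      using that u[of j "u j"] u[of "Suc j" "u j"] right[of j "u j"] by auto
    moreover have "u (Suc j) - 1 \<le> u j"
    proof (cases "u (Suc j)")
      case (Suc m)
      then show ?thesis
        using that u[of "Suc j" "Suc m"] left[of j m] u[of j m] by auto
    qed simp
    ultimately show ?thesis by linarith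
  qed
  ultimately obtain p where "length p = n" "\<And>j. j \<le> n \<Longrightarrow> ups p j = u j"
    using path_of_ups by blast
  then show ?thesis using u by auto
qed

lemma path_le_refl [simp]: "P \<preceq> P"
  by (simp add: path_le_def)

lemma path_le_trans: "P \<preceq> Q \<Longrightarrow> Q \<preceq> R \<Longrightarrow> P \<preceq> R"
  unfolding path_le_def by (metis order_trans)

lemma path_le_length: "P \<preceq> Q \<Longrightarrow> length P = length Q"
  by (simp add: path_le_def)

lemma finite_paths: "finite {P :: path. length P = n}"
proof -
  have "finite (UNIV :: step set)"
    by (rule finite_subset[of _ "{U, D}"]) (auto intro: step.exhaust)
  from finite_lists_length_eq[OF this] show ?thesis by simp
qed

lemma path_le_top: "P \<preceq> path_top (length P)"
  by (auto simp: path_le_iff_ups ups_path_top ups_le) (simp add: path_top_def)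

section \<open>Small intervals as inequalities between upstep counts\<close>

lemma valleys_ups:
  "j \<in> valleys P \<longleftrightarrow> 1 \<le> j \<and> j \<le> length P \<and> ups P j = ups P (j - 1) \<and>
     (j < length P \<longrightarrow> ups P (Suc j) = Suc (ups P j))"
proof (cases "1 \<le> j \<and> j \<le> length P")
  case True
  then obtain i where i: "j = Suc i" "i < length P" by (cases j) auto
  have "P ! i = D \<longleftrightarrow> P ! i \<noteq> U" by (cases "P ! i") auto
  then show ?thesis using i by (auto simp: valleys_def ups_Suc)
qed (auto simp: valleys_def)

lemma ups_turn:
  assumes S: "S \<subseteq> valleys P" and j: "j \<le> length P"
  shows "ups (turn S P) j = ups P j + (if j \<in> S then 1 else 0)"
  using j
proof (induction j)
  case 0
  then show ?case using S by (auto simp: valleys_def)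
next
  case (Suc j)
  have 1: "P ! j = D \<and> j \<notin> S" if "Suc j \<in> S"
    using subsetD[OF S, of "Suc j"] subsetD[OF S, of j] that Suc.prems by (auto simp: valleys_def)
  have 2: "P ! j = U" if "j \<in> S"
    using subsetD[OF S, of j] that Suc.prems by (auto simp: valleys_def)
  show ?case using Suc 1 2 by (auto simp: ups_Suc turn_def)
qed

text \<open>In heights, the last two inequalities say that \<open>Q\<close> exceeds each
  neighbouring point of \<open>P\<close> by at most 1: a new box needs its two supporting boxes
  already below \<open>P\<close>. No set of valleys has to be carried along.\<close>

definition small_step :: "path \<Rightarrow> path \<Rightarrow> bool" where
  "small_step P Q \<longleftrightarrow> length P = length Q \<and> (\<forall>j\<le>length P. ups P j \<le> ups Q j) \<and>
     (\<forall>j<length P. ups Q j \<le> ups P (Suc j) \<and> ups Q (Suc j) \<le> Suc (ups P j))"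

lemma small_step_turn:
  assumes "S \<subseteq> valleys P"
  shows "small_step P (turn S P)"
  unfolding small_step_def
proof (intro conjI allI impI)
  show len: "length P = length (turn S P)" by (simp add: turn_def)
  fix j assume j: "j < length P"
  show "ups (turn S P) j \<le> ups P (Suc j)"
    using ups_turn[OF assms, of j] subsetD[OF assms, of j] j ups_Suc_bounds[OF j]
    by (auto simp: valleys_ups)
  show "ups (turn S P) (Suc j) \<le> Suc (ups P j)"
    using ups_turn[OF assms, of "Suc j"] subsetD[OF assms, of "Suc j"] j ups_Suc_bounds[OF j]
    by (auto simp: valleys_ups split: if_splits)
qed (use ups_turn[OF assms] in auto)

text \<open>The set to turn consists of the abscissae where the counts differ. There the two
  neighbour inequalities leave room for exactly one more upstep and force \<open>P\<close> to go
  down before the point and up after it.\<close>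

lemma small_step_iff_turn:
  "P \<preceq> Q \<and> (\<exists>S\<subseteq>valleys P. Q = turn S P) \<longleftrightarrow> small_step P Q"
proof
  assume step: "small_step P Q"
  define S where "S = {j \<in> {1..length P}. ups Q j \<noteq> ups P j}"
  have len: "length Q = length P" using step by (simp add: small_step_def)
  have S: "ups Q j = Suc (ups P j) \<and> j \<in> valleys P" if "j \<in> S" for j
  proof -
    from that obtain i where i: "j = Suc i" "i < length P" by (cases j) (auto simp: S_def)
    have "ups P j < ups Q j" "ups Q j \<le> Suc (ups P i)" "ups P i \<le> ups P j"
      using that i step ups_Suc_bounds[of i P] by (auto simp: S_def small_step_def order.strict_iff_order)
    moreover have "ups Q j \<le> ups P (Suc j)" "ups P (Suc j) \<le> Suc (ups P j)" if "j < length P"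
      using that step ups_Suc_bounds[of j P] by (auto simp: small_step_def)
    ultimately show ?thesis using i by (auto simp: valleys_ups)
  qed
  then have sub: "S \<subseteq> valleys P" by auto
  have "Q = turn S P"
  proof (rule path_eqI_ups)
    show "length Q = length (turn S P)" by (simp add: turn_def len)
    fix j assume "j \<le> length Q"
    then show "ups Q j = ups (turn S P) j"
      using ups_turn[OF sub, of j] S[of j] len by (cases j) (auto simp: S_def)
  qed
  then show "P \<preceq> Q \<and> (\<exists>S\<subseteq>valleys P. Q = turn S P)"
    using sub step by (auto simp: path_le_iff_ups small_step_def)
qed (use small_step_turn in auto)

lemma small_intervals_iff:
  "small_intervals c \<longleftrightarrow> (\<forall>t. Suc t < length c \<longrightarrow> small_step (c ! t) (c ! Suc t))"
  unfolding small_intervals_def small_step_iff_turn by (simp add: successively_conv_nth)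

section \<open>The degree of \<open>D # U # P\<close>\<close>

text \<open>If both supporting boxes are present and the box itself is missing, then
  \<open>P\<close> has a valley there, possibly at its end, and the filling turns it.\<close>

lemma ups_filling_lower:
  assumes j: "j < length P" and le: "m \<le> ups P j"
    and next_le: "Suc j < length P \<Longrightarrow> Suc m \<le> ups P (Suc (Suc j))"
  shows "Suc m \<le> ups (filling P) (Suc j)"
proof (cases "Suc m \<le> ups P (Suc j)")
  case False
  then have eq: "ups P (Suc j) = m" "ups P j = m"
    using le ups_Suc_bounds[OF j] by auto
  then have "Suc j \<in> valleys P"
    using j next_le ups_Suc_bounds[of "Suc j" P] by (auto simp: valleys_ups)
  then show ?thesis
    using ups_turn[of "valleys P" P "Suc j"] j eq by (simp add: filling_def)
qed (use ups_turn[of "valleys P" P "Suc j"] j in \<open>simp add: filling_def\<close>)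

lemma ups_DU:
  "ups (D # U # P) (Suc 0) = 0" "ups (D # U # P) (Suc (Suc j)) = Suc (ups P j)"
  by (simp_all add: ups_def)

definition nonneg :: "path \<Rightarrow> bool" where
  "nonneg P \<longleftrightarrow> (\<forall>j\<le>length P. 0 \<le> height P j)"

lemma nonneg_ups: "nonneg P \<Longrightarrow> j \<le> length P \<Longrightarrow> j \<le> 2 * ups P j"
  by (auto simp: nonneg_def height_ups)

text \<open>The points below the top start with the endpoint of the first step \<open>D\<close>; one step of the chain
  can move this leftmost point by at most one abscissa.\<close>

lemma small_chain_upper:
  assumes "\<And>t. t < T \<Longrightarrow> small_step (p t) (p (Suc t))" and "p 0 = D # U # P"
    and "t \<le> T" and "t < length P + 2"
  shows "length (p t) = length P + 2 \<and> ups (p t) (Suc t) \<le> t"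
  using assms(3,4)
proof (induction t)
  case 0
  then show ?case using assms(2) by (simp add: ups_DU)
next
  case (Suc t)
  then show ?case using assms(1)[of t] by (force simp: small_step_def)
qed

lemma degree_DU:
  assumes "nonneg P"
  shows "degree (D # U # P) = length P + 2"
proof -
  define R where "R = D # U # P"
  define N where "N = length P + 2"
  define p where "p t = (filling ^^ t) R" for t
  have len: "length (p t) = N" for t
    by (induction t) (auto simp: p_def R_def N_def filling_def turn_def)
  have step: "small_step (p t) (p (Suc t))" for t
    using small_step_turn[of "valleys (p t)" "p t"] by (simp add: p_def filling_def)
  \<comment> \<open>After \<open>t\<close> fillings every box of upper height
    \<open>2 * m - j\<close> at most \<open>t\<close> is present. For \<open>t = 0\<close> this is
    nonnegativity of \<open>P\<close>, and for \<open>t = N\<close> it gives the top.\<close>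
  have lower: "m \<le> ups (p t) j" if "m \<le> j" "2 * m \<le> t + j" "j \<le> N" for t j m
    using that
  proof (induction t arbitrary: j m)
    case 0
    show ?case
    proof (cases "j \<le> 1")
      case False
      then obtain i where i: "j = Suc (Suc i)"
        by (metis One_nat_def Suc_le_mono le0 not0_implies_Suc)
      then show ?thesis
        using 0 nonneg_ups[OF assms, of i] by (simp add: p_def R_def ups_DU N_def)
    qed (use 0 in auto)
  next
    case (Suc t)
    show ?case
    proof (cases m)
      case (Suc l)
      then obtain i where i: "j = Suc i" using Suc.prems by (cases j) auto
      have "Suc l \<le> ups (filling (p t)) (Suc i)"
        using Suc.prems i Suc len[of t]
        by (intro ups_filling_lower) (simp_all add: Suc.IH)
      then show ?thesis by (simp add: i Suc p_def)
    qed simp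
  qed
  have "p N = path_top N"
  proof (rule path_eqI_ups)
    show "length (p N) = length (path_top N)" by (simp add: len path_top_def)
    show "ups (p N) j = ups (path_top N) j" if "j \<le> length (p N)" for j
      using that len[of N] lower[of j j N] ups_le[of j "p N"] by (simp add: ups_path_top)
  qed
  moreover have "p k \<noteq> path_top N" if "k < N" for k
  proof
    assume "p k = path_top N"
    then have "ups (p k) (Suc k) = Suc k" using that by (simp add: ups_path_top)
    moreover have "ups (p k) (Suc k) \<le> k"
      using small_chain_upper[of k p P k] step that by (simp add: p_def R_def N_def)
    ultimately show False by simp
  qed
  ultimately have "(LEAST k. p k = path_top N) = N"
    by (intro Least_equality) (auto simp: not_less[symmetric])
  then show ?thesis
    by (simp add: degree_def p_def R_def N_def)
qed

section \<open>Pinned multichains\<close>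

definition pinned :: "int \<Rightarrow> path \<Rightarrow> path \<Rightarrow> bool" where
  "pinned r P Q \<longleftrightarrow> (\<forall>j\<le>length P. height P j \<le> r \<longrightarrow> height Q j = height P j)"

text \<open>The sequences are infinite so that no length has to be tracked: the level rises with the
  index, and once it exceeds all heights of \<open>P\<close> the sequence is constantly
  \<open>P\<close>. Chains lead to \<open>r = - 1\<close>, multichains of type v to
  \<open>r = 0\<close>.\<close>

definition pinned_chains :: "int \<Rightarrow> path \<Rightarrow> (nat \<Rightarrow> path) set" where
  "pinned_chains r P = {c. \<forall>i. P \<preceq> c i \<and> c (Suc i) \<preceq> c i \<and> pinned (r + int i) P (c i)}"

text \<open>This allows the relation \<open>slack_of\<close> to serve as the correspondence, without
  composing two explicit constructions to show that they are inverse.\<close>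

lemma card_eq_of_correspondence:
  assumes AB: "\<And>a. a \<in> A \<Longrightarrow> \<exists>!b. b \<in> B \<and> R a b"
    and BA: "\<And>b. b \<in> B \<Longrightarrow> \<exists>!a. a \<in> A \<and> R a b"
  shows "card A = card B"
proof -
  define f where "f a = (THE b. b \<in> B \<and> R a b)" for a
  have f: "f a \<in> B \<and> R a (f a)" if "a \<in> A" for a
    unfolding f_def by (rule theI') (use AB that in blast)
  have "bij_betw f A B"
    unfolding bij_betw_def inj_on_def using f AB BA by (auto simp: image_iff) metis+
  then show ?thesis by (rule bij_betw_same_card)
qed

section \<open>Bounds on filling times in a chain of minimal length\<close>

locale small_chain =
  fixes P :: path and c :: "path list"
  assumes nonneg: "nonneg P"
    and c: "length c = length P + 3" "hd c = D # U # P" "last c = path_top (length P + 2)"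
      "small_intervals c"
begin

abbreviation "N \<equiv> length P + 2"
abbreviation "u t j \<equiv> ups (c ! t) j"

lemma first: "c ! 0 = D # U # P"
  using c by (metis add_is_0 hd_conv_nth list.size(3) zero_neq_numeral)

lemma last_top: "c ! N = path_top N"
  using c last_conv_nth[of c] by (cases "c = []") auto

lemma step: "t < N \<Longrightarrow> small_step (c ! t) (c ! Suc t)"
  using c by (auto simp: small_intervals_iff)

lemma len: "t \<le> N \<Longrightarrow> length (c ! t) = N"
proof (induction t)
  case (Suc t)
  then show ?case using step[of t] by (simp add: small_step_def)
qed (simp add: first)

lemma u_path:
  assumes "t \<le> N" "j < N"
  shows "u t j \<le> u t (Suc j)" "u t (Suc j) \<le> Suc (u t j)"
  using ups_Suc_bounds[of j "c ! t"] len[of t] assms by auto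

lemma u_step:
  assumes "t < N"
  shows "j \<le> N \<Longrightarrow> u t j \<le> u (Suc t) j"
    "j < N \<Longrightarrow> u (Suc t) j \<le> u t (Suc j)"
    "j < N \<Longrightarrow> u (Suc t) (Suc j) \<le> Suc (u t j)"
  using step[OF assms] len[of t] assms by (auto simp: small_step_def)

lemma u_first: "u 0 (Suc 0) = 0" "u 0 (Suc (Suc j)) = Suc (ups P j)"
  by (simp_all add: first ups_DU)

lemma u_mono: "t \<le> t' \<Longrightarrow> t' \<le> N \<Longrightarrow> j \<le> N \<Longrightarrow> u t j \<le> u t' j"
proof (induction rule: dec_induct)
  case (step n)
  then show ?case using u_step(1)[of n j] by simp
qed simp

lemma u_le: "t \<le> N \<Longrightarrow> j \<le> N \<Longrightarrow> u t j \<le> j"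
  using ups_le[of j "c ! t"] len[of t] by simp

text \<open>The leftmost deficit at time \<open>t\<close> is at abscissa \<open>Suc t\<close> or
  before; to the right of it a path gains at most one upstep per abscissa, so the deficit
  persists.\<close>

lemma u_upper: "t < j \<Longrightarrow> j \<le> N \<Longrightarrow> u t j < j"
proof (induction j)
  case (Suc j)
  show ?case
  proof (cases "t = j")
    case True
    then show ?thesis
      using small_chain_upper[of N "(!) c" P t] Suc.prems step first by simp
  next
    case False
    then have "u t j < j" using Suc by simp
    then show ?thesis using u_path(2)[of t j] Suc.prems False by simp
  qed
qed simp

text \<open>The deadline, by induction backwards from the top: a box is present if the one above it
  to the right is present one time later. At the right end the box above it to the left takes
  over.\<close>

lemma u_lower: "t \<le> N \<Longrightarrow> j \<le> N \<Longrightarrow> m \<le> j \<Longrightarrow> 2 * m \<le> t + j \<Longrightarrow> m \<le> u t j"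
proof (induction t arbitrary: j m rule: inc_induct)
  case base
  then show ?case using ups_path_top[of j N] unfolding last_top by simp
next
  case (step t)
  show ?case
  proof (cases "j < N")
    case True
    then have "Suc m \<le> u (Suc t) (Suc j)" using step by simp
    then show ?thesis using u_step(3)[of t j] True step.hyps by simp
  next
    case False
    then have j: "j = Suc (N - 1)" using step by simp
    have "m \<le> u (Suc t) (N - 1)" using step j by simp
    then show ?thesis using u_step(2)[of t "N - 1"] j step.hyps by simp
  qed
qed

lemma u_one: "t \<le> N \<Longrightarrow> u t (Suc 0) = (if t = 0 then 0 else 1)"
  using u_le[of t 1] u_lower[of t 1 1] u_first by auto

end

text \<open>A box is addressed by its abscissa \<open>j\<close> and the number \<open>m\<close> of upsteps of a path that has it as
  its last filled box at \<open>j\<close>, so its upper corner has height \<open>2 * m - j\<close>.  The box is filled in \<open>q i\<close>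
  iff it is filled at the time \<open>2 * m - j - i - 1\<close> of the chain: a box of upper height \<open>y\<close> has to be
  filled at time \<open>y\<close> at the latest, and \<open>q\<close> records how much earlier this happens.  The first
  two steps \<open>D\<close> and \<open>U\<close> account for the shift of \<open>j\<close> and \<open>m\<close>.\<close>

definition slack_of :: "path \<Rightarrow> path list \<Rightarrow> (nat \<Rightarrow> path) \<Rightarrow> bool" where
  "slack_of P c q \<longleftrightarrow> (\<forall>t\<le>length P + 2. \<forall>j\<le>length P. \<forall>m\<le>Suc j.
     Suc m \<le> ups (c ! t) (Suc (Suc j)) \<longleftrightarrow>
       2 * m \<le> t + j \<or> m \<le> ups (q (2 * m - j - t - 1)) j)"

section \<open>The correspondence between chains and pinned multichains\<close>

lemma (in small_chain) slack_exists:
  obtains q where "q \<in> pinned_chains (- 1) P" "slack_of P c q"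
proof -
  \<comment> \<open>The truncated subtraction is intended: for upper height at most
    \<open>i + 1\<close> the time becomes 0, so the box belongs to \<open>q i\<close> only if it
    lies below \<open>P\<close>. This yields the pinning.\<close>
  define A where "A i j m \<longleftrightarrow> m \<le> j \<and> m < u (2 * m - j - i - 1) (Suc (Suc j))" for i j m
  have "\<exists>p. length p = length P \<and> (\<forall>j\<le>length P. \<forall>m. m \<le> ups p j \<longleftrightarrow> A i j m)" for i
  proof -
    have "A i j 0" if "j \<le> length P" for j
      by (simp add: A_def u_first)
    \<comment> \<open>The next box at the same abscissa is two higher, so it is tested at most two
      times later. Two small steps, through abscissa \<open>Suc j\<close> and back, add at most one
      box there.\<close>
    moreover have "A i j m" if "A i j (Suc m)" "j \<le> length P" for j m
    proof -
      define t where "t = 2 * m - j - i - 1"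
      have "Suc m < u (2 * Suc m - j - i - 1) (Suc (Suc j))" "m < j"
        using that by (auto simp: A_def)
      moreover have "2 * Suc m - j - i - 1 \<le> Suc (Suc t)" "Suc t < N"
        using that by (auto simp: t_def A_def)
      ultimately have "Suc m < u (Suc (Suc t)) (Suc (Suc j))"
        using u_mono[of "2 * Suc m - j - i - 1" "Suc (Suc t)" "Suc (Suc j)"] that by simp
      then show ?thesis
        using u_step(3)[of "Suc t" "Suc j"] u_step(2)[of t "Suc j"] that \<open>Suc t < N\<close> \<open>m < j\<close>
        unfolding A_def t_def[symmetric] by linarith
    qed
    moreover have "A i j m" if "A i (Suc j) (Suc m)" "j < length P" for j m
    proof -
      define t where "t = 2 * m - j - i - 1"
      have 1: "Suc m < u (2 * m - j - i) (Suc (Suc (Suc j)))" "m \<le> j"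
        using that by (auto simp: A_def Suc_diff_le numeral_2_eq_2)
      have "t < N" "2 * m - j - i = t \<or> 2 * m - j - i = Suc t"
        using 1 that by (auto simp: t_def)
      then have "m < u t (Suc (Suc j))"
        using 1 that u_path(2)[of t "Suc (Suc j)"] u_step(3)[of t "Suc (Suc j)"] by auto
      then show ?thesis using 1 by (simp add: A_def t_def)
    qed
    moreover have "A i (Suc j) m" if "A i j m" "j < length P" for j m
    proof -
      define t where "t = 2 * m - Suc j - i - 1"
      have 1: "m < u (2 * m - j - i - 1) (Suc (Suc j))" "m \<le> j"
        using that by (auto simp: A_def)
      have "t < N" "2 * m - j - i - 1 = t \<or> 2 * m - j - i - 1 = Suc t"
        using 1 that by (auto simp: t_def)
      then have "m < u t (Suc (Suc (Suc j)))"
        using 1 that u_path(1)[of t "Suc (Suc j)"] u_step(2)[of t "Suc (Suc j)"] by auto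
      then show ?thesis using 1 by (simp add: A_def t_def)
    qed
    moreover have "A i j m \<Longrightarrow> m \<le> j" for j m
      by (simp add: A_def)
    ultimately show ?thesis by (intro path_of_region) blast+
  qed
  then obtain q where len_q: "\<And>i. length (q i) = length P"
    and q: "\<And>i j m. j \<le> length P \<Longrightarrow> m \<le> ups (q i) j \<longleftrightarrow> A i j m"
    by metis
  show ?thesis
  proof
    have above: "P \<preceq> q i" for i
      unfolding path_le_iff_ups
    proof (intro conjI allI impI)
      fix j assume j: "j \<le> length P"
      define m where "m = ups P j"
      have "m \<le> j" using ups_le j by (simp add: m_def)
      then have "u 0 (Suc (Suc j)) \<le> u (2 * m - j - i - 1) (Suc (Suc j))"
        using j by (intro u_mono) auto
      then have "A i j m" using \<open>m \<le> j\<close> by (simp add: A_def u_first m_def)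
      then show "ups P j \<le> ups (q i) j" using q j m_def by blast
    qed (simp add: len_q)
    moreover have "q (Suc i) \<preceq> q i" for i
      unfolding path_le_iff_ups
    proof (intro conjI allI impI)
      fix j assume "j \<le> length (q (Suc i))"
      then have j: "j \<le> length P" by (simp add: len_q)
      define m where "m = ups (q (Suc i)) j"
      have "A (Suc i) j m" using q j m_def by blast
      moreover have "u (2 * m - j - Suc i - 1) (Suc (Suc j)) \<le> u (2 * m - j - i - 1) (Suc (Suc j))"
        using j calculation by (intro u_mono) (auto simp: A_def)
      ultimately have "A i j m" by (simp add: A_def)
      then show "ups (q (Suc i)) j \<le> ups (q i) j" using q j m_def by blast
    qed (simp add: len_q)
    moreover have "pinned (- 1 + int i) P (q i)" for i
      unfolding pinned_def
    proof (intro allI impI)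
      fix j assume j: "j \<le> length P" and low: "height P j \<le> - 1 + int i"
      then have "2 * Suc (ups P j) - j - i - 1 = 0" by (simp add: height_ups)
      then have "\<not> A i j (Suc (ups P j))" by (simp add: A_def u_first)
      then have "ups (q i) j \<le> ups P j" using q[OF j] not_less_eq_eq by blast
      then show "height (q i) j = height P j"
        using above[of i] j by (auto simp: path_le_iff_ups height_ups len_q intro: antisym)
    qed
    ultimately show "q \<in> pinned_chains (- 1) P" by (auto simp: pinned_chains_def)
    show "slack_of P c q"
      unfolding slack_of_def
    proof (intro allI impI)
      fix t j m assume t: "t \<le> length P + 2" and j: "j \<le> length P" and m: "m \<le> Suc j"
      show "Suc m \<le> u t (Suc (Suc j)) \<longleftrightarrow> 2 * m \<le> t + j \<or> m \<le> ups (q (2 * m - j - t - 1)) j"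
      proof (cases "2 * m \<le> t + j")
        case True
        then show ?thesis using u_lower[of t "Suc (Suc j)" "Suc m"] t j m by simp
      next
        case False
        then have "2 * m - j - (2 * m - j - t - 1) - 1 = t" by simp
        \<comment> \<open>The value \<open>m = Suc j\<close> is out of reach for \<open>q i\<close>
          at \<open>j\<close>, but the chain has two more steps and may attain it. Before the
          deadline \<open>u_upper\<close> excludes it.\<close>
        moreover have "u t (Suc (Suc j)) < Suc (Suc j)" if "m = Suc j"
          using that False j by (intro u_upper) auto
        ultimately show ?thesis
          using False m by (cases "m = Suc j") (auto simp: q[OF j] A_def)
      qed
    qed
  qed
qed

lemma pinned_chains_length: "q \<in> pinned_chains r P \<Longrightarrow> length (q i) = length P"
  by (auto simp: pinned_chains_def path_le_def)

text \<open>The chain decides the boxes of upper height greater than \<open>i + 1\<close> in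
  \<open>q i\<close>; pinning decides all lower ones.\<close>

lemma (in small_chain) slack_unique:
  assumes "q \<in> pinned_chains (- 1) P" "slack_of P c q"
    and "q' \<in> pinned_chains (- 1) P" "slack_of P c q'"
  shows "q = q'"
proof (rule ext, rule path_eqI_ups)
  fix i j
  show "length (q i) = length (q' i)" using assms by (simp add: pinned_chains_length)
  assume "j \<le> length (q i)"
  then have j: "j \<le> length P" using assms by (simp add: pinned_chains_length)
  have "ups x j \<le> ups y j"
    if x: "x = r i" "r \<in> pinned_chains (- 1) P" "slack_of P c r"
      and y: "y = r' i" "r' \<in> pinned_chains (- 1) P" "slack_of P c r'" for x y r r'
  proof (cases "2 * ups x j \<le> j + i + 1")
    case True
    show ?thesis
    proof (cases "ups x j \<le> ups P j")
      case True
      moreover have "P \<preceq> y" using y by (auto simp: pinned_chains_def)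
      ultimately show ?thesis using j by (auto simp: path_le_iff_ups intro: order_trans)
    next
      case False
      \<comment> \<open>An upstep count above that of \<open>P\<close> but with upper height at most
        \<open>i + 1\<close> would put \<open>P\<close> within the pinned level.\<close>
      then have "height P j \<le> - 1 + int i" using True j by (simp add: height_ups)
      then have "height x j = height P j" using x j by (auto simp: pinned_chains_def pinned_def)
      then show ?thesis using False x j by (simp add: height_ups pinned_chains_length)
    qed
  next
    case False
    define m where "m = ups x j"
    have m: "m \<le> j" using x j ups_le[of j x] by (simp add: m_def pinned_chains_length)
    define t where "t = 2 * m - j - i - 1"
    have t: "t \<le> length P + 2" "\<not> 2 * m \<le> t + j" "2 * m - j - t - 1 = i"
      using False m j by (auto simp: t_def m_def)
    have "m \<le> ups (r i) j \<longleftrightarrow> Suc m \<le> u t (Suc (Suc j))"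
      using x t m j unfolding slack_of_def by (metis le_SucI)
    moreover have "m \<le> ups (r' i) j \<longleftrightarrow> Suc m \<le> u t (Suc (Suc j))"
      using y t m j unfolding slack_of_def by (metis le_SucI)
    ultimately show ?thesis using x y by (simp add: m_def)
  qed
  then show "ups (q i) j = ups (q' i) j" using assms by (auto intro!: antisym)
qed

lemma slack_determines_chain:
  assumes "small_chain P c" "small_chain P c'" "slack_of P c q" "slack_of P c' q"
  shows "c = c'"
proof (rule nth_equalityI)
  interpret c: small_chain P c by fact
  interpret c': small_chain P c' by fact
  show "length c = length c'" by (simp add: c.c c'.c)
  fix t assume "t < length c"
  then have t: "t \<le> length P + 2" by (simp add: c.c)
  show "c ! t = c' ! t"
  proof (rule path_eqI_ups)
    show "length (c ! t) = length (c' ! t)" using t by (simp add: c.len c'.len)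
    fix j assume "j \<le> length (c ! t)"
    then have j: "j \<le> length P + 2" using t by (simp add: c.len)
    show "ups (c ! t) j = ups (c' ! t) j"
    \<comment> \<open>\<open>slack_of\<close> speaks only of abscissae from 2 on. At abscissa 1
      every chain of minimal length has its upstep from time 1 on.\<close>
    proof (cases "j \<le> 1")
      case True
      then have "j = 0 \<or> j = Suc 0" by auto
      then show ?thesis using t by (auto simp: c.u_one c'.u_one)
    next
      case False
      then obtain i where i: "j = Suc (Suc i)" by (metis One_nat_def Suc_le_mono le0 not0_implies_Suc)
      have *: "Suc m \<le> ups (c ! t) j \<longleftrightarrow> Suc m \<le> ups (c' ! t) j" if "m \<le> Suc i" for m
        using assms(3,4) that t j i unfolding slack_of_def by simp
      have "ups (c ! t) j \<le> j" "ups (c' ! t) j \<le> j"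
        using c.u_le c'.u_le t j by auto
      then show ?thesis
        using *[of "ups (c ! t) j - 1"] *[of "ups (c' ! t) j - 1"] i
        by (cases "ups (c ! t) j"; cases "ups (c' ! t) j") auto
    qed
  qed
qed

text \<open>The index \<open>2 * m - j - t - 1\<close> does not change when one goes back one time
  and down one diagonal in either direction. Hence the neighbour inequalities of
  \<open>small_step\<close> reduce to the path conditions of a single \<open>q i\<close>, and growth
  in time to \<open>q (Suc i) \<preceq> q i\<close>. Pinning gives the start, the deadline the
  top.\<close>

lemma chain_of_slack:
  assumes nonneg: "nonneg P" and q: "q \<in> pinned_chains (- 1) P"
  obtains c where "small_chain P c" "slack_of P c q"
proof -
  define N where "N = length P + 2"
  have above: "ups P j \<le> ups (q i) j" and mono: "ups (q (Suc i)) j \<le> ups (q i) j"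
    if "j \<le> length P" for i j
    using q that pinned_chains_length[OF q] by (auto simp: pinned_chains_def path_le_iff_ups)
  have q_path: "ups (q i) j \<le> ups (q i) (Suc j)" "ups (q i) (Suc j) \<le> Suc (ups (q i) j)"
    if "j < length P" for i j
    using ups_Suc_bounds[of j "q i"] that pinned_chains_length[OF q] by auto
  \<comment> \<open>The first alternative is the deadline, the second the slack;
    \<open>j - 2\<close> and \<open>m - 1\<close> remove the initial \<open>D # U\<close>.\<close>
  define B where "B t j m \<longleftrightarrow> m \<le> j \<and> (2 * m \<le> t + j \<or>
      (2 \<le> j \<and> 1 \<le> m \<and> m - 1 \<le> ups (q (2 * m - j - t - 1)) (j - 2)))" for t j m
  have B_right: "B t (Suc j) m" if "B (Suc t) j m" "j < N" for t j m
  proof (cases "2 * m \<le> t + Suc j")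
    case False
    then have "2 \<le> j" "1 \<le> m" "m - 1 \<le> ups (q (2 * m - j - Suc t - 1)) (j - 2)" "m \<le> j"
      using that by (auto simp: B_def)
    moreover have "2 * m - j - Suc t - 1 = 2 * m - Suc j - t - 1" "Suc j - 2 = Suc (j - 2)"
      "j - 2 < length P"
      using calculation that by (auto simp: N_def)
    ultimately show ?thesis
      using q_path(1)[of "j - 2" "2 * m - Suc j - t - 1"] unfolding B_def by auto
  qed (use that in \<open>auto simp: B_def\<close>)
  have B_left: "B t j m" if "B (Suc t) (Suc j) (Suc m)" "j < N" for t j m
  proof (cases "2 * m \<le> t + j")
    case False
    then have *: "1 \<le> j" "m \<le> ups (q (2 * m - j - t - 1)) (j - 1)" "m \<le> j"
      using that by (auto simp: B_def numeral_2_eq_2)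
    show ?thesis
    proof (cases "j = 1")
      case True
      then show ?thesis using * by (simp add: B_def)
    next
      case False
      then have j: "j - 1 = Suc (j - 2)" "2 \<le> j" "j - 2 < length P"
        using * that by (auto simp: N_def)
      have "m - 1 \<le> ups (q (2 * m - j - t - 1)) (j - 2)"
        using *(2) q_path(2)[OF j(3), of "2 * m - j - t - 1"] unfolding j(1) by linarith
      then show ?thesis using * j(2) False \<open>\<not> 2 * m \<le> t + j\<close> by (simp add: B_def)
    qed
  qed (use that in \<open>auto simp: B_def\<close>)
  have B_mono: "B (Suc t) j m" if "B t j m" "j \<le> N" for t j m
  proof (cases "2 * m \<le> Suc t + j")
    case False
    define i where "i = 2 * m - j - Suc t - 1"
    have i: "2 * m - j - t - 1 = Suc i" using False by (simp add: i_def)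
    have "j - 2 \<le> length P" using that by (simp add: N_def)
    then show ?thesis
      using that(1) False mono[of "j - 2" i] unfolding B_def i i_def[symmetric] by auto
  qed (use that in \<open>auto simp: B_def\<close>)
  have "\<exists>p. length p = N \<and> (\<forall>j\<le>N. \<forall>m. m \<le> ups p j \<longleftrightarrow> B t j m)" for t
  proof -
    \<comment> \<open>The path conditions at one time follow by waiting one time and then moving
      along a diagonal back to time \<open>t\<close>.\<close>
    have 1: "B t (Suc j) m" if "B t j m" "j < N" for j m
      using B_right[of t j m] B_mono[of t j m] that by simp
    have 2: "B t j m" if "B t (Suc j) (Suc m)" "j < N" for j m
      using B_left[of t j m] B_mono[of t "Suc j" "Suc m"] that by simp
    have 3: "B t j m" if "B t j (Suc m)" "j \<le> N" for j m
    proof (cases j)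
      case 0
      then show ?thesis using that by (simp add: B_def)
    next
      case (Suc i)
      then show ?thesis using 1[of i m] 2[of i m] that by simp
    qed
    have 4: "B t j 0" and 5: "B t j m \<Longrightarrow> m \<le> j" for j m
      by (simp_all add: B_def)
    show ?thesis
      using 1 2 3 4 5 by (intro path_of_region) blast+
  qed
  then obtain p where len_p: "\<And>t. length (p t) = N"
    and p: "\<And>t j m. j \<le> N \<Longrightarrow> m \<le> ups (p t) j \<longleftrightarrow> B t j m"
    by metis
  have step: "small_step (p t) (p (Suc t))" for t
    unfolding small_step_def len_p
  proof (intro conjI allI impI)
    fix j
    show "ups (p t) j \<le> ups (p (Suc t)) j" if "j \<le> N"
      using B_mono[of t j "ups (p t) j"] p[of j "ups (p t) j" t] p[of j "ups (p t) j" "Suc t"] that by simp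
    assume j: "j < N"
    show "ups (p (Suc t)) j \<le> ups (p t) (Suc j)"
      using B_right[of t j "ups (p (Suc t)) j"] p[of j "ups (p (Suc t)) j" "Suc t"]
        p[of "Suc j" "ups (p (Suc t)) j" t] j by simp
    show "ups (p (Suc t)) (Suc j) \<le> Suc (ups (p t) j)"
      using B_left[of t j "ups (p (Suc t)) (Suc j) - 1"] p[of "Suc j" "ups (p (Suc t)) (Suc j)" "Suc t"]
        p[of j "ups (p (Suc t)) (Suc j) - 1" t] j
      by (cases "ups (p (Suc t)) (Suc j)") simp_all
  qed simp
  have first: "p 0 = D # U # P"
  proof (rule path_eqI_ups)
    show "length (p 0) = length (D # U # P)" by (simp add: len_p N_def)
    fix j assume "j \<le> length (p 0)"
    then have j: "j \<le> N" by (simp add: len_p)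
    consider "j = 0" | "j = Suc 0" | i where "j = Suc (Suc i)" by (metis not0_implies_Suc)
    then show "ups (p 0) j = ups (D # U # P) j"
    proof cases
      case 2
      then show ?thesis using p[OF j, of 1 0] by (simp add: B_def ups_DU)
    next
      case (3 i)
      then have i: "i \<le> length P" using j by (simp add: N_def)
      have "B 0 j (Suc m) \<longleftrightarrow> m \<le> ups P i" for m
      proof
        assume "B 0 j (Suc m)"
        then consider "2 * m \<le> i" | "i < 2 * m" "m \<le> ups (q (2 * m - i - 1)) i"
          by (force simp: B_def 3)
        then show "m \<le> ups P i"
        proof cases
          case 1
          then show ?thesis using nonneg_ups[OF nonneg i] by simp
        next
          case 2
          show ?thesis
          proof (rule ccontr)
            assume "\<not> m \<le> ups P i"
            \<comment> \<open>The level is just high enough: \<open>P\<close> misses box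
              \<open>m\<close> at \<open>i\<close>, so its height is at most
              \<open>2 * m - i - 2\<close>, one less than the index of the path in question.\<close>
            then have "height P i \<le> - 1 + int (2 * m - i - 1)"
              using 2 i by (simp add: height_ups)
            then have "height (q (2 * m - i - 1)) i = height P i"
              using q i by (auto simp: pinned_chains_def pinned_def)
            then show False
              using \<open>\<not> m \<le> ups P i\<close> 2 i pinned_chains_length[OF q] by (simp add: height_ups)
          qed
        qed
      next
        assume "m \<le> ups P i"
        then show "B 0 j (Suc m)"
          using above[OF i, of "2 * m - i - 1"] ups_le[OF i] by (auto simp: B_def 3)
      qed
      moreover have "B 0 j 0" by (simp add: B_def)
      ultimately have "m \<le> ups (p 0) j \<longleftrightarrow> m \<le> Suc (ups P i)" for m
        unfolding p[OF j] by (cases m) simp_all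
      then have "ups (p 0) j = Suc (ups P i)" by (metis order_antisym order_refl)
      then show ?thesis by (simp add: 3 ups_DU)
    qed simp
  qed
  have top: "p N = path_top N"
  proof (rule path_eqI_ups)
    show "length (p N) = length (path_top N)" by (simp add: len_p path_top_def)
    show "ups (p N) j = ups (path_top N) j" if "j \<le> length (p N)" for j
      using p[of j j N] that ups_le[of j "p N"] by (simp add: len_p B_def ups_path_top)
  qed
  show ?thesis
  proof
    show "small_chain P (map p [0..<Suc N])"
      using nonneg first top step
      by unfold_locales
        (auto simp: N_def hd_map last_map small_intervals_iff simp del: upt_Suc)
    show "slack_of P (map p [0..<Suc N]) q"
      unfolding slack_of_def
    proof (intro allI impI)
      fix t j m assume t: "t \<le> length P + 2" and j: "j \<le> length P" and m: "m \<le> Suc j"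
      have "2 * Suc m - Suc (Suc j) - t - 1 = 2 * m - j - t - 1" by simp
      then show "Suc m \<le> ups (map p [0..<Suc N] ! t) (Suc (Suc j)) \<longleftrightarrow>
          2 * m \<le> t + j \<or> m \<le> ups (q (2 * m - j - t - 1)) j"
        using t j m p[of "Suc (Suc j)" "Suc m" t] by (simp add: N_def B_def del: upt_Suc)
    qed
  qed
qed

lemma num_small_chains_DU:
  assumes "nonneg P"
  shows "num_small_chains (D # U # P) = card (pinned_chains (- 1) P)"
proof -
  have "num_small_chains (D # U # P) = card {c. small_chain P c}"
    unfolding num_small_chains_def degree_DU[OF assms]
    by (rule arg_cong[of _ _ card]) (use assms in \<open>auto simp: small_chain_def\<close>)
  also have "\<dots> = card (pinned_chains (- 1) P)"
  proof (rule card_eq_of_correspondence[where R = "slack_of P"])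
    fix c assume "c \<in> {c. small_chain P c}"
    then interpret small_chain P c by simp
    show "\<exists>!q. q \<in> pinned_chains (- 1) P \<and> slack_of P c q"
      using slack_exists slack_unique by metis
  next
    fix q assume "q \<in> pinned_chains (- 1) P"
    then show "\<exists>!c. c \<in> {c. small_chain P c} \<and> slack_of P c q"
      using chain_of_slack[OF assms] slack_determines_chain by (metis mem_Collect_eq)
  qed
  finally show ?thesis .
qed

section \<open>Pinned multichains of Dyck paths and multichains of type v\<close>

lemma height_step:
  "j < length P \<Longrightarrow> height P (Suc j) = height P j + 1 \<or> height P (Suc j) = height P j - 1"
  by (cases "P ! j") (auto simp: height_Suc)

lemma path_eqI_height:
  "length P = length Q \<Longrightarrow> (\<And>j. j \<le> length P \<Longrightarrow> height P j = height Q j) \<Longrightarrow> P = Q"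
  by (rule path_eqI_ups) (auto simp: height_ups)

lemma valleys_height:
  "j \<in> valleys P \<longleftrightarrow> 1 \<le> j \<and> j \<le> length P \<and> height P (j - 1) = height P j + 1 \<and>
     (j < length P \<longrightarrow> height P (Suc j) = height P j + 1)"
  by (cases j) (auto simp: valleys_ups height_ups)

lemma pinned_mono: "pinned r P Q \<Longrightarrow> r' \<le> r \<Longrightarrow> pinned r' P Q"
  by (auto simp: pinned_def)

lemma pinned_refl [simp]: "pinned r P P"
  by (simp add: pinned_def)

text \<open>A lowest point at which the two paths differ is a valley of the lower one.\<close>

lemma pinned_of_valleys:
  assumes le: "P \<preceq> Q"
    and val: "\<And>v. v \<in> valleys P \<Longrightarrow> height P v \<le> r \<Longrightarrow> height Q v = height P v"
  shows "pinned r P Q"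
proof (rule ccontr)
  define B where "B = {j. j \<le> length P \<and> height P j \<le> r \<and> height Q j \<noteq> height P j}"
  assume "\<not> pinned r P Q"
  then have "B \<noteq> {}" by (auto simp: pinned_def B_def)
  moreover have "finite B" by (simp add: B_def)
  ultimately obtain j where j: "j \<in> B" and min: "\<And>i. i \<in> B \<Longrightarrow> height P j \<le> height P i"
    using arg_min_if_finite[of B "height P"] by (metis not_less)
  have len: "length Q = length P" and PQ: "\<And>i. i \<le> length P \<Longrightarrow> height P i \<le> height Q i"
    using le by (auto simp: path_le_def)
  have high: "height P j + 2 \<le> height Q j"
    using j PQ[of j] by (auto simp: B_def height_ups len)
  have nbr: "height P j \<le> height P i" if "i \<le> length P" "height Q j \<le> height Q i + 1" for i
    using min[of i] high that j by (force simp: B_def)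
  have "j \<noteq> 0"
  proof
    assume "j = 0"
    then show False using j by (simp add: B_def)
  qed
  then obtain i where i: "j = Suc i" "i < length P" using j by (cases j) (auto simp: B_def)
  have "height P i = height P j + 1"
    using nbr[of i] i height_step[of i P] height_step[of i Q] len by auto
  moreover have "height P (Suc j) = height P j + 1" if "j < length P"
    using nbr[of "Suc j"] that height_step[of j P] height_step[of j Q] len by auto
  ultimately have "j \<in> valleys P" using i by (auto simp: valleys_height)
  then show False using val j by (auto simp: B_def)
qed

text \<open>Points of height at most \<open>r\<close> on either path are common to both. At such a
  valley of \<open>P\<close> the neighbours are one higher, and \<open>Q\<close>, being above
  \<open>P\<close>, must follow; the other direction uses pinning of the neighbours as well.\<close>

lemma valley_points_of_pinned:
  assumes le: "P \<preceq> Q" and pin: "pinned r P Q"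
  shows "{p \<in> valley_points Q. snd p \<le> r} = {p \<in> valley_points P. snd p \<le> r}"
proof -
  have len: "length Q = length P" and PQ: "\<And>i. i \<le> length P \<Longrightarrow> height P i \<le> height Q i"
    using le by (auto simp: path_le_def)
  have eq: "height Q j = height P j" if "j \<le> length P" "height P j \<le> r" for j
    using pin that by (simp add: pinned_def)
  have PtoQ: "j \<in> valleys Q" if v: "j \<in> valleys P" and low: "height P j \<le> r" for j
  proof -
    obtain i where i: "j = Suc i" "i < length P" using v by (cases j) (auto simp: valleys_height)
    have j: "height Q j = height P j" using eq low i by simp
    show ?thesis
      using v i j PQ[of i] PQ[of "Suc j"] height_step[of i Q] height_step[of j Q] len
      by (auto simp: valleys_height)
  qed
  have QtoP: "j \<in> valleys P" if v: "j \<in> valleys Q" and low: "height Q j \<le> r" for j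
  proof -
    obtain i where i: "j = Suc i" "i < length P"
      using v len by (cases j) (auto simp: valleys_height)
    have j: "height Q j = height P j" using eq[of j] PQ[of j] low i by simp
    have "height Q i = height Q j + 1" using v i by (simp add: valleys_height)
    \<comment> \<open>A neighbour of \<open>P\<close> one lower would be pinned and so would lie on
      \<open>Q\<close>, which is higher there.\<close>
    then have "height P i = height P j + 1"
      using eq[of i] height_step[OF i(2)] i j low by auto
    moreover have "height P (Suc j) = height P j + 1" if "j < length P"
    proof -
      have "height Q (Suc j) = height Q j + 1" using v that len by (simp add: valleys_height)
      then show ?thesis using eq[of "Suc j"] height_step[OF that] that j low by auto
    qed
    ultimately show ?thesis using i by (simp add: valleys_height)
  qed
  have "(j, h) \<in> valley_points Q \<longleftrightarrow> (j, h) \<in> valley_points P" if "h \<le> r" for j h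
  proof
    assume "(j, h) \<in> valley_points Q"
    then have j: "j \<in> valleys Q" "h = height Q j" by (auto simp: valley_points_def)
    then have "j \<le> length P" using len by (simp add: valleys_def)
    then have "height P j = h" using eq[of j] PQ[of j] j that by simp
    then show "(j, h) \<in> valley_points P" using QtoP j that by (auto simp: valley_points_def)
  next
    assume "(j, h) \<in> valley_points P"
    then have j: "j \<in> valleys P" "h = height P j" by (auto simp: valley_points_def)
    then have "height Q j = h" using eq[of j] that by (simp add: valleys_def)
    then show "(j, h) \<in> valley_points Q" using PtoQ j that by (auto simp: valley_points_def)
  qed
  then show ?thesis by auto
qed

text \<open>No height of \<open>P\<close> exceeds its length, so beyond that index every member is
  \<open>P\<close>.\<close>

lemma finite_pinned_chains: "finite (pinned_chains 0 P)"
proof (rule finite_subset)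
  show "finite {c. \<forall>i. (i \<in> {..length P} \<longrightarrow> c i \<in> {Q. length Q = length P}) \<and>
      (i \<notin> {..length P} \<longrightarrow> c i = P)}"
    by (intro finite_set_of_finite_funs finite_paths) simp
  have "c i = P" if c: "c \<in> pinned_chains 0 P" and i: "length P < i" for c i
  proof (rule path_eqI_height)
    show "length (c i) = length P" using c by (rule pinned_chains_length)
    fix j assume "j \<le> length (c i)"
    then have j: "j \<le> length P" using c by (simp add: pinned_chains_length)
    then have "height P j \<le> int i" using i ups_le[OF j] by (simp add: height_ups)
    then show "height (c i) j = height P j" using c j by (auto simp: pinned_chains_def pinned_def)
  qed
  then show "pinned_chains 0 P \<subseteq> {c. \<forall>i. (i \<in> {..length P} \<longrightarrow> c i \<in> {Q. length Q = length P}) \<and>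
      (i \<notin> {..length P} \<longrightarrow> c i = P)}"
    by (auto simp: pinned_chains_length)
qed

lemma dyck_pinned:
  assumes "dyck a" "a \<preceq> s" "pinned r a s" "0 \<le> r"
  shows "dyck s"
  using assms unfolding dyck_def path_le_def pinned_def by (metis order_refl order_trans)

lemma valleys_le_hv:
  assumes "v \<in> valleys a"
  shows "height a v \<le> int (hv a)"
proof -
  have "finite (valleys a)"
    by (rule finite_subset[of _ "{..length a}"]) (auto simp: valleys_def)
  then have "height a v \<le> Max (height a ` valleys a)" using assms by simp
  then show ?thesis by (simp add: hv_def)
qed

text \<open>Agreement at all valleys propagates to all points. This is why \<open>hv a\<close> is
  the right length for type v: from that index on the sequence is constantly
  \<open>a\<close>.\<close>

lemma pinned_hv_eq:
  assumes "a \<preceq> b" "pinned r a b" "int (hv a) \<le> r"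
  shows "b = a"
proof -
  have "pinned (int (length a)) a b"
  proof (rule pinned_of_valleys)
    fix v assume v: "v \<in> valleys a"
    then have "height a v \<le> r" "v \<le> length a"
      using valleys_le_hv[OF v] assms(3) by (auto simp: valleys_def)
    then show "height b v = height a v" using assms(2) by (simp add: pinned_def)
  qed (rule assms)
  moreover have "height a j \<le> int (length a)" if "j \<le> length a" for j
    using ups_le[OF that] that by (simp add: height_ups)
  ultimately show ?thesis
    using assms(1) by (intro path_eqI_height) (auto simp: pinned_def path_le_def)
qed

lemma pinned_chain_of_type_v:
  assumes c: "type_v c" "hd c = a" "a \<noteq> []"
  shows "(\<lambda>i. if i \<le> hv a then c ! (hv a - i) else a) \<in> pinned_chains 0 a"
proof -
  define h where "h = hv a"
  have len: "length c = h + 1" and succ: "\<And>j. Suc j \<le> h \<Longrightarrow> c ! j \<preceq> c ! Suc j"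
    using c by (auto simp: type_v_def Let_def h_def successively_conv_nth)
  have vp_step: "{p \<in> valley_points (c ! j). snd p \<le> int h - int j} =
      {p \<in> valley_points (c ! (j - 1)). snd p \<le> int h - int j}" if "1 \<le> j" "j \<le> h" for j
    using c that by (auto simp: type_v_def Let_def h_def)
  have c0: "c ! 0 = a" using c(2) len hd_conv_nth[of c] by (cases c) auto
  have above: "a \<preceq> c ! j" if "j \<le> h" for j
    using that
  proof (induction j)
    case (Suc j)
    then show ?case using succ[of j] path_le_trans by auto
  qed (simp add: c0)
  \<comment> \<open>The height bounds decrease along the list, so the comparisons of consecutive
    members combine to a comparison with \<open>a\<close>.\<close>
  have vp: "{p \<in> valley_points (c ! j). snd p \<le> int h - int j} =
      {p \<in> valley_points a. snd p \<le> int h - int j}" if "j \<le> h" for j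
    using that
  proof (induction j)
    case (Suc j)
    have IH: "{p \<in> valley_points (c ! j). snd p \<le> int h - int j} =
        {p \<in> valley_points a. snd p \<le> int h - int j}"
      using Suc by simp
    have "{p \<in> valley_points (c ! Suc j). snd p \<le> int h - int (Suc j)} =
        {p \<in> {p \<in> valley_points (c ! j). snd p \<le> int h - int j}. snd p \<le> int h - int (Suc j)}"
      using vp_step[of "Suc j"] Suc.prems by auto
    also have "\<dots> = {p \<in> valley_points a. snd p \<le> int h - int (Suc j)}"
      unfolding IH by auto
    finally show ?case .
  qed (simp add: c0)
  have pin: "pinned (int i) a (c ! (h - i))" if "i \<le> h" for i
  proof (rule pinned_of_valleys)
    show "a \<preceq> c ! (h - i)" using above by simp
    fix v assume v: "v \<in> valleys a" "height a v \<le> int i"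
    have "(v, height a v) \<in> {p \<in> valley_points (c ! (h - i)). snd p \<le> int h - int (h - i)}"
      unfolding vp[OF diff_le_self] using v that by (auto simp: valley_points_def)
    then show "height (c ! (h - i)) v = height a v" by (auto simp: valley_points_def)
  qed
  have mono: "c ! (h - Suc i) \<preceq> c ! (h - i)" if "Suc i \<le> h" for i
    using succ[of "h - Suc i"] that by (simp add: Suc_diff_Suc)
  show ?thesis
    using above pin mono by (auto simp: pinned_chains_def c0 h_def[symmetric] not_less_eq_eq)
qed

lemma type_v_of_pinned_chain:
  assumes a: "dyck a" "a \<noteq> []" and f: "f \<in> pinned_chains 0 a"
  shows "type_v (map (\<lambda>j. f (hv a - j)) [0..<Suc (hv a)])"
proof -
  define h where "h = hv a"
  define l where "l = map (\<lambda>j. f (h - j)) [0..<Suc h]"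
  have above: "a \<preceq> f i" and mono: "f (Suc i) \<preceq> f i" and pin: "pinned (int i) a (f i)" for i
    using f by (auto simp: pinned_chains_def)
  have nth: "l ! j = f (h - j)" if "j \<le> h" for j
    using that by (simp add: l_def del: upt_Suc)
  have len: "length l = h + 1" by (simp add: l_def)
  have hd: "hd l = a"
    using pinned_hv_eq[OF above pin, of h] by (simp add: l_def hd_map h_def del: upt_Suc)
  have "dyck (f i)" for i
    using dyck_pinned[OF a(1) above pin] by simp
  then have "\<forall>P\<in>set l. dyck P" by (auto simp: l_def)
  moreover have "successively (\<preceq>) l"
    unfolding successively_conv_nth
  proof (intro allI impI)
    fix j assume "Suc j < length l"
    then show "l ! j \<preceq> l ! Suc j"
      using mono[of "h - Suc j"] by (simp add: len nth Suc_diff_Suc)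
  qed
  moreover have "{p \<in> valley_points (l ! j). snd p \<le> int h - int j} =
      {p \<in> valley_points (l ! (j - 1)). snd p \<le> int h - int j}" if "j \<in> {1..h}" for j
  proof -
    \<comment> \<open>Both members are compared with \<open>a\<close> at the smaller of their two
      levels.\<close>
    have 1: "pinned (int h - int j) a (f (h - j))"
      using pin[of "h - j"] that by (auto intro: pinned_mono)
    have 2: "pinned (int h - int j) a (f (h - (j - 1)))"
      using pin[of "h - (j - 1)"] that by (auto intro: pinned_mono)
    show ?thesis
      using that nth[of j] nth[of "j - 1", OF le_trans[OF diff_le_self]]
        valley_points_of_pinned[OF above 1] valley_points_of_pinned[OF above 2] by simp
  qed
  ultimately have "type_v l"
    unfolding type_v_def Let_def hd h_def[symmetric] using len by blast
  then show ?thesis by (simp add: l_def h_def)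
qed

text \<open>The bijection reverses the order of the members, so the last path \<open>s\<close> of
  the multichain becomes the first of the sequence. The part of the sequence beyond
  \<open>hv a\<close> carries no information.\<close>

lemma num_v_pinned_chains:
  assumes a: "dyck a" and le: "a \<preceq> s"
  shows "num_v a s = card {c \<in> pinned_chains 0 a. c 0 = s}"
proof (cases "a = []")
  case True
  then have "s = []" using le by (simp add: path_le_def)
  \<comment> \<open>For the empty path \<open>hv\<close> has no meaning; the convention value 1
    counts the constant empty sequence.\<close>
  have "{c \<in> pinned_chains 0 a. c 0 = s} = {\<lambda>_. []}"
  proof (intro set_eqI iffI)
    fix c assume "c \<in> {c \<in> pinned_chains 0 a. c 0 = s}"
    then show "c \<in> {\<lambda>_. []}" using True pinned_chains_length[of c 0 a] by auto
  qed (auto simp: True \<open>s = []\<close> pinned_chains_def)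
  then show ?thesis by (simp add: num_v_def True \<open>s = []\<close>)
next
  case False
  define h where "h = hv a"
  let ?C = "{c. type_v c \<and> hd c = a \<and> last c = s}" and ?F = "{c \<in> pinned_chains 0 a. c 0 = s}"
  let ?f = "\<lambda>c i. if i \<le> h then c ! (h - i) else a"
  let ?g = "\<lambda>f. map (\<lambda>j. f (h - j)) [0..<Suc h]"
  have len: "length c = Suc h" if "c \<in> ?C" for c
    using that by (auto simp: type_v_def Let_def h_def)
  have stable: "f i = a" if "f \<in> ?F" "h \<le> i" for f i
    using that pinned_hv_eq[of a "f i" "int i"] by (auto simp: pinned_chains_def h_def)
  have "bij_betw ?f ?C ?F"
  proof (rule bij_betw_byWitness[where f' = ?g])
    show "\<forall>c\<in>?C. ?g (?f c) = c"
      using len by (auto intro!: nth_equalityI simp del: upt_Suc)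
    show "\<forall>f\<in>?F. ?f (?g f) = f"
    proof (intro ballI ext)
      fix f i assume "f \<in> ?F"
      then show "?f (?g f) i = f i"
        using stable[of f i] by (auto simp del: upt_Suc)
    qed
    show "?f ` ?C \<subseteq> ?F"
    proof (rule image_subsetI)
      fix c assume c: "c \<in> ?C"
      then have "c ! h = s" using len[OF c] last_conv_nth[of c] by (cases c) auto
      then show "?f c \<in> ?F"
        using c pinned_chain_of_type_v[of c a] False unfolding h_def by simp
    qed
    show "?g ` ?F \<subseteq> ?C"
    proof (rule image_subsetI)
      fix f assume f: "f \<in> ?F"
      then show "?g f \<in> ?C"
        using type_v_of_pinned_chain[OF a False, of f] stable[OF f, of h]
        by (simp add: hd_map last_map h_def del: upt_Suc)
    qed
  qed
  then show ?thesis using False by (simp add: num_v_def bij_betw_same_card)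
qed

text \<open>The sequences are grouped by their first member, which is a Dyck path because level 0
  pins the endpoint of \<open>a\<close>.\<close>

lemma sum_num_v:
  fixes G :: "path \<Rightarrow> nat"
  assumes a: "dyck a"
  shows "(\<Sum>x\<in>pinned_chains 0 a. G (x 0)) =
    (\<Sum>s\<in>{t. dyck t \<and> length t = length a \<and> a \<preceq> t}. num_v a s * G s)"
proof -
  let ?D = "{t. dyck t \<and> length t = length a \<and> a \<preceq> t}"
  have "finite ?D" by (rule finite_subset[OF _ finite_paths]) auto
  moreover have "(\<lambda>x. x 0) ` pinned_chains 0 a \<subseteq> ?D"
    using dyck_pinned[OF a, of _ 0] by (force simp: pinned_chains_def path_le_def)
  ultimately have "(\<Sum>x\<in>pinned_chains 0 a. G (x 0)) =
      (\<Sum>s\<in>?D. \<Sum>x\<in>{x \<in> pinned_chains 0 a. x 0 = s}. G (x 0))"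
    by (intro sum.group[symmetric] finite_pinned_chains)
  also have "\<dots> = (\<Sum>s\<in>?D. num_v a s * G s)"
    by (rule sum.cong) (auto simp: num_v_pinned_chains[OF a])
  finally show ?thesis .
qed

section \<open>Splitting at the end of the first Dyck factor\<close>

lemma height_append:
  "height (x @ y) j = (if j \<le> length x then height x j
     else height x (length x) + height y (j - length x))"
  by (simp add: height_def)

lemma height_U_Cons: "height (U # y) (Suc j) = 1 + height y j"
  by (simp add: height_def)

lemma path_le_U_Cons: "U # x \<preceq> U # y \<longleftrightarrow> x \<preceq> y"
proof -
  have "(\<forall>j\<le>Suc (length x). height (U # x) j \<le> height (U # y) j) \<longleftrightarrow>
      (\<forall>j\<le>length x. height x j \<le> height y j)"
    by (metis Suc_le_mono add_le_cancel_left height_0 height_U_Cons order_refl not0_implies_Suc)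
  then show ?thesis by (simp add: path_le_def)
qed

lemma path_le_U_ConsE:
  assumes "U # x \<preceq> y"
  obtains z where "y = U # z" "x \<preceq> z"
proof (cases y)
  case Nil
  then show ?thesis using assms by (simp add: path_le_def)
next
  case (Cons t z)
  have "height (U # x) 1 \<le> height y 1" using assms by (simp add: path_le_def)
  then have "t = U" using Cons by (cases t) (simp_all add: height_def)
  then show ?thesis using that assms Cons by (simp add: path_le_U_Cons)
qed

lemma path_le_append: "x \<preceq> x' \<Longrightarrow> y \<preceq> y' \<Longrightarrow> x @ y \<preceq> x' @ y'"
  unfolding path_le_def by (auto simp: height_append intro!: add_mono)

lemma path_le_append_split:
  assumes "x @ y \<preceq> z" and "height z (length x) = height x (length x)"
  shows "x \<preceq> take (length x) z" "y \<preceq> drop (length x) z"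
proof -
  define x' y' where "x' = take (length x) z" and "y' = drop (length x) z"
  have z: "z = x' @ y'" by (simp add: x'_def y'_def)
  have lz: "length z = length x + length y" using assms(1) by (simp add: path_le_def)
  have len: "length x' = length x" "length y' = length y" using lz by (simp_all add: x'_def y'_def)
  have le: "height (x @ y) j \<le> height (x' @ y') j" if "j \<le> length x + length y" for j
    using assms(1) that z by (simp add: path_le_def)
  have end_eq: "height x' (length x) = height x (length x)"
    using assms(2) unfolding z by (simp add: height_append len)
  have "height x j \<le> height x' j" if "j \<le> length x" for j
    using le[of j] that by (simp add: height_append len)
  then show "x \<preceq> take (length x) z"
    unfolding x'_def[symmetric] path_le_def using len by simp
  have "height y j \<le> height y' j" if "j \<le> length y" for j
    using le[of "length x + j"] that end_eq by (cases j) (auto simp: height_append len)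
  then show "y \<preceq> drop (length x) z"
    unfolding y'_def[symmetric] path_le_def using len by simp
qed

lemma pinned_append_iff:
  assumes "length x = length a" "length y = length b"
    and "height a (length a) = 0" "height x (length a) = 0"
  shows "pinned r (a @ b) (x @ y) \<longleftrightarrow> pinned r a x \<and> pinned r b y"
proof
  assume pin: "pinned r (a @ b) (x @ y)"
  have "height x j = height a j" if "j \<le> length a" "height a j \<le> r" for j
    using pin that assms unfolding pinned_def by (auto simp: height_append dest!: spec[of _ j])
  moreover have "height y j = height b j" if "j \<le> length b" "height b j \<le> r" for j
  proof -
    have "height (a @ b) (length a + j) = height b j" "height (x @ y) (length a + j) = height y j"
      using assms by (cases j; simp add: height_append)+
    then show ?thesis using pin that unfolding pinned_def by (metis add_left_mono length_append)
  qed
  ultimately show "pinned r a x \<and> pinned r b y" by (simp add: pinned_def)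
next
  assume "pinned r a x \<and> pinned r b y"
  then show "pinned r (a @ b) (x @ y)"
    using assms unfolding pinned_def by (auto simp: height_append)
qed

lemma pinned_U_Cons: "pinned r (U # b) (U # y) \<longleftrightarrow> pinned (r - 1) b y"
proof -
  have "pinned r (U # b) (U # y) \<longleftrightarrow>
      (\<forall>j\<le>length b. height (U # b) (Suc j) \<le> r \<longrightarrow> height (U # y) (Suc j) = height (U # b) (Suc j))"
    unfolding pinned_def by (metis Suc_le_mono height_0 length_Cons not0_implies_Suc)
  then show ?thesis by (auto simp: pinned_def height_U_Cons algebra_simps)
qed

lemma pinned_below_zero: "nonneg P \<Longrightarrow> r < 0 \<Longrightarrow> pinned r P Q"
  by (force simp: nonneg_def pinned_def)

text \<open>The end of \<open>a\<close> has height 0 and is pinned in every member, so all members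
  split there. Level \<open>Suc l\<close> for \<open>U # P\<close> is level \<open>l\<close> for
  \<open>P\<close>, hence the right parts from index 1 on form a member of
  \<open>pinned_chains 0 P\<close>. The right part at index 0 stays free above the next one.\<close>

lemma bij_betw_pinned_chains_append:
  assumes a: "dyck a" and P: "nonneg P"
  shows "bij_betw (\<lambda>(x, c, V) i. x i @ (case i of 0 \<Rightarrow> V | Suc l \<Rightarrow> U # c l))
    (SIGMA x:pinned_chains 0 a. SIGMA c:pinned_chains 0 P. {V. U # c 0 \<preceq> V})
    (pinned_chains 0 (a @ U # P))" (is "bij_betw ?f ?S ?T")
proof (rule bij_betw_byWitness[where f' = "\<lambda>c. (\<lambda>i. take (length a) (c i),
    \<lambda>i. drop (Suc (length a)) (c (Suc i)), drop (length a) (c 0))"])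
  have a0: "height a (length a) = 0" using a by (simp add: dyck_def)
  have split: "\<exists>x V. c i = x @ U # V \<and> length x = length a \<and> length V = length P \<and> a \<preceq> x \<and>
      pinned (int i) a x \<and> P \<preceq> V \<and> pinned (int i - 1) P V \<and> height x (length a) = 0"
    if c: "c \<in> ?T" for c i
  proof -
    have le: "a @ U # P \<preceq> c i" and pin: "pinned (int i) (a @ U # P) (c i)"
      using c by (auto simp: pinned_chains_def)
    have "height (c i) (length a) = 0"
      using pin a0 by (auto simp: pinned_def height_append dest!: spec[of _ "length a"])
    then have 1: "a \<preceq> take (length a) (c i)" "U # P \<preceq> drop (length a) (c i)"
      using path_le_append_split[OF le] a0 by auto
    then obtain V where V: "drop (length a) (c i) = U # V" "P \<preceq> V"
      by (elim path_le_U_ConsE)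
    define x where "x = take (length a) (c i)"
    have ci: "c i = x @ U # V" unfolding x_def V(1)[symmetric] by simp
    have len: "length x = length a" "length V = length P"
      using 1 V by (auto simp: x_def path_le_def)
    have x0: "height x (length a) = 0"
      using \<open>height (c i) (length a) = 0\<close> len by (simp add: ci height_append)
    have "pinned (int i) a x \<and> pinned (int i) (U # P) (U # V)"
      using pin len x0 a0 unfolding ci by (subst (asm) pinned_append_iff) auto
    moreover have "a \<preceq> x" using 1 by (simp add: x_def)
    ultimately show ?thesis
      using ci len x0 V(2) by (intro exI[of _ x] exI[of _ V]) (simp add: pinned_U_Cons)
  qed
  \<comment> \<open>Level 0 meets \<open>U # P\<close> only at its start, so pinning imposes nothing
    on \<open>V\<close>.\<close>
  have nonneg_UP: "j = 0" if "j \<le> Suc (length P)" "height (U # P) j \<le> 0" for j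
  proof (cases j)
    case (Suc l)
    then have "0 \<le> height P l" using P that by (simp add: nonneg_def)
    then show ?thesis using Suc that by (simp add: height_U_Cons)
  qed simp
  show "\<forall>s\<in>?S. (\<lambda>c. (\<lambda>i. take (length a) (c i), \<lambda>i. drop (Suc (length a)) (c (Suc i)),
      drop (length a) (c 0))) (?f s) = s"
    by (auto simp: pinned_chains_length)
  show "\<forall>c\<in>?T. ?f ((\<lambda>c. (\<lambda>i. take (length a) (c i), \<lambda>i. drop (Suc (length a)) (c (Suc i)),
      drop (length a) (c 0))) c) = c"
  proof
    fix c assume c: "c \<in> ?T"
    show "?f ((\<lambda>c. (\<lambda>i. take (length a) (c i), \<lambda>i. drop (Suc (length a)) (c (Suc i)),
      drop (length a) (c 0))) c) = c"
    proof
      fix i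
      show "?f ((\<lambda>c. (\<lambda>i. take (length a) (c i), \<lambda>i. drop (Suc (length a)) (c (Suc i)),
        drop (length a) (c 0))) c) i = c i"
        using split[OF c, of i] by (auto split: nat.split)
    qed
  qed
  show "?f ` ?S \<subseteq> ?T"
  proof (rule image_subsetI, clarify)
    fix x c V assume x: "x \<in> pinned_chains 0 a" and c: "c \<in> pinned_chains 0 P" and V: "U # c 0 \<preceq> V"
    let ?y = "\<lambda>i. case i of 0 \<Rightarrow> V | Suc l \<Rightarrow> U # c l"
    have x': "a \<preceq> x i" "x (Suc i) \<preceq> x i" "pinned (int i) a (x i)" for i
      using x by (auto simp: pinned_chains_def)
    have c': "P \<preceq> c i" "c (Suc i) \<preceq> c i" "pinned (int i) P (c i)" for i
      using c by (auto simp: pinned_chains_def)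
    have mono: "?y (Suc i) \<preceq> ?y i" for i
      using V c' by (auto simp: path_le_U_Cons split: nat.split)
    have above: "U # P \<preceq> ?y i" for i
      using c' V path_le_trans[of "U # P" "U # c 0" V] by (auto simp: path_le_U_Cons split: nat.split)
    have x0: "height (x i) (length a) = 0" for i
      using x'(3)[of i] a0 by (auto simp: pinned_def dest!: spec[of _ "length a"])
    have "pinned (int i) (U # P) (?y i)" for i
    proof (cases i)
      case 0
      then show ?thesis unfolding pinned_def using nonneg_UP by force
    next
      case (Suc l)
      then show ?thesis using c'(3)[of l] by (simp add: pinned_U_Cons)
    qed
    then have "pinned (int i) (a @ U # P) (x i @ ?y i)" for i
      using x'(3)[of i] x'(1)[of i] above[of i] a0 x0
      by (subst pinned_append_iff) (auto simp: path_le_def)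
    then show "(\<lambda>i. x i @ ?y i) \<in> ?T"
      using x' mono above unfolding pinned_chains_def by (auto intro: path_le_append)
  qed
  show "(\<lambda>c. (\<lambda>i. take (length a) (c i), \<lambda>i. drop (Suc (length a)) (c (Suc i)),
      drop (length a) (c 0))) ` ?T \<subseteq> ?S"
  proof (rule image_subsetI)
    fix c assume c: "c \<in> ?T"
    obtain x V where s: "\<And>i. c i = x i @ U # V i" "\<And>i. length (x i) = length a"
      "\<And>i. a \<preceq> x i" "\<And>i. pinned (int i) a (x i)" "\<And>i. P \<preceq> V i" "\<And>i. pinned (int i - 1) P (V i)"
      "\<And>i. height (x i) (length a) = 0"
      using split[OF c] by metis
    have "x (Suc i) \<preceq> x i \<and> V (Suc i) \<preceq> V i" for i
    proof -
      have "x (Suc i) @ U # V (Suc i) \<preceq> c i"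
        using c s(1) by (metis (mono_tags, lifting) mem_Collect_eq pinned_chains_def)
      moreover have "height (c i) (length (x (Suc i))) = height (x (Suc i)) (length (x (Suc i)))"
        by (simp add: s height_append)
      ultimately have "x (Suc i) \<preceq> x i" "U # V (Suc i) \<preceq> U # V i"
        using path_le_append_split s(1,2) by (metis append_eq_conv_conj)+
      then show ?thesis by (simp add: path_le_U_Cons)
    qed
    moreover have "pinned (int i) P (V (Suc i))" for i
      using s(6)[of "Suc i"] by simp
    ultimately show "(\<lambda>i. take (length a) (c i), \<lambda>i. drop (Suc (length a)) (c (Suc i)),
        drop (length a) (c 0)) \<in> ?S"
      by (simp add: s(1,2)) (simp add: pinned_chains_def s path_le_U_Cons)
  qed
qed

lemma finite_above: "finite {V. Q \<preceq> V}"
  by (rule finite_subset[OF _ finite_paths[of "length Q"]]) (auto simp: path_le_def)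

lemma sum_pinned_chains_append:
  fixes F :: "path \<Rightarrow> nat"
  assumes "dyck a" "nonneg P"
  shows "(\<Sum>c\<in>pinned_chains 0 (a @ U # P). F (c 0)) =
    (\<Sum>x\<in>pinned_chains 0 a. \<Sum>c\<in>pinned_chains 0 P. \<Sum>V | U # c 0 \<preceq> V. F (x 0 @ V))"
proof -
  have "(\<Sum>c\<in>pinned_chains 0 (a @ U # P). F (c 0)) =
      (\<Sum>(x, c, V)\<in>(SIGMA x:pinned_chains 0 a. SIGMA c:pinned_chains 0 P. {V. U # c 0 \<preceq> V}).
        F (x 0 @ V))"
    by (subst sum.reindex_bij_betw[OF bij_betw_pinned_chains_append[OF assms], symmetric])
      (auto intro: sum.cong)
  also have "\<dots> = (\<Sum>x\<in>pinned_chains 0 a. \<Sum>(c, V)\<in>(SIGMA c:pinned_chains 0 P. {V. U # c 0 \<preceq> V}).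
      F (x 0 @ V))"
    by (subst sum.Sigma) (auto simp: finite_pinned_chains finite_above)
  also have "\<dots> = (\<Sum>x\<in>pinned_chains 0 a. \<Sum>c\<in>pinned_chains 0 P. \<Sum>V | U # c 0 \<preceq> V. F (x 0 @ V))"
    by (subst sum.Sigma) (auto simp: finite_pinned_chains finite_above)
  finally show ?thesis .
qed

section \<open>Families of Dyck prefixes\<close>

lemma dyck_prefix_iff_nonneg: "dyck_prefix P \<longleftrightarrow> nonneg P"
proof
  assume "dyck_prefix P"
  then obtain Q where "dyck (P @ Q)" by (auto simp: dyck_prefix_def)
  then show "nonneg P"
    unfolding nonneg_def dyck_def by (metis height_append le_add1 length_append order_trans)
next
  assume P: "nonneg P"
  define m where "m = nat (height P (length P))"
  have m: "int m = height P (length P)" using P by (simp add: m_def nonneg_def)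
  have D: "height (replicate m D) j = - int j" if "j \<le> m" for j
    using that by (induction j) (auto simp: height_Suc)
  have "dyck (P @ replicate m D)"
    using P m by (auto simp: dyck_def nonneg_def height_append D)
  then show "dyck_prefix P" by (auto simp: dyck_prefix_def)
qed

lemma nonneg_append: "dyck a \<Longrightarrow> nonneg P \<Longrightarrow> nonneg (a @ P)"
  by (auto simp: nonneg_def dyck_def height_append)

lemma nonneg_U_Cons:
  assumes "nonneg P" shows "nonneg (U # P)"
  unfolding nonneg_def
proof (intro allI impI)
  fix j assume "j \<le> length (U # P)"
  then show "0 \<le> height (U # P) j"
    using assms by (cases j) (auto simp: nonneg_def height_U_Cons)
qed

lemma nonneg_path_le: "nonneg P \<Longrightarrow> P \<preceq> Q \<Longrightarrow> nonneg Q"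
  unfolding nonneg_def path_le_def by (metis order_trans)

abbreviation (input) dyck_above :: "path \<Rightarrow> path set" where
  "dyck_above a \<equiv> {t. dyck t \<and> length t = length a \<and> a \<preceq> t}"

definition prefix_families :: "nat \<Rightarrow> (nat \<Rightarrow> path) \<Rightarrow> (nat \<Rightarrow> path) set" where
  "prefix_families k s = {V \<in> {1..k + 1} \<rightarrow>\<^sub>E {W. dyck_prefix W}.
     V (k + 1) = [] \<and> (\<forall>i\<in>{1..k}. U # s i @ V (i + 1) \<preceq> V i)}"

text \<open>This splits off \<open>V 1\<close>. That it is a Dyck prefix need not be required of
  \<open>W\<close>, since a path above the nonnegative path \<open>U # s 1 @ V 1\<close> is
  nonnegative. The value \<open>undefined\<close> at 0 keeps the families extensional.\<close>

lemma bij_betw_prefix_families_Suc: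
  assumes "dyck (s 1)"
  shows "bij_betw (\<lambda>(V, W) i. if i = 0 then undefined else if i = 1 then W else V (i - 1))
    (SIGMA V:prefix_families k (s \<circ> Suc). {W. U # s 1 @ V 1 \<preceq> W}) (prefix_families (Suc k) s)"
    (is "bij_betw ?f ?S ?T")
proof (rule bij_betw_byWitness[where f' = "\<lambda>V. (\<lambda>i. if i = 0 then undefined else V (Suc i), V 1)"])
  show "\<forall>p\<in>?S. (\<lambda>V. (\<lambda>i. if i = 0 then undefined else V (Suc i), V 1)) (?f p) = p"
    by (auto simp: prefix_families_def PiE_def extensional_def fun_eq_iff)
  show "\<forall>V\<in>?T. ?f (\<lambda>i. if i = 0 then undefined else V (Suc i), V 1) = V"
    by (auto simp: prefix_families_def PiE_def extensional_def fun_eq_iff)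
  show "?f ` ?S \<subseteq> ?T"
  proof (rule image_subsetI, clarify)
    fix V W assume V: "V \<in> prefix_families k (s \<circ> Suc)" and W: "U # s 1 @ V 1 \<preceq> W"
    have V': "\<And>i. i \<in> {1..k + 1} \<Longrightarrow> nonneg (V i)" "\<And>i. i \<notin> {1..k + 1} \<Longrightarrow> V i = undefined"
      "V (k + 1) = []" "\<And>i. i \<in> {1..k} \<Longrightarrow> U # s (Suc i) @ V (i + 1) \<preceq> V i"
      using V by (auto simp: prefix_families_def dyck_prefix_iff_nonneg PiE_def Pi_def extensional_def)
    let ?V = "\<lambda>i. if i = 0 then undefined else if i = 1 then W else V (i - 1)"
    have "nonneg W"
      using nonneg_path_le[OF _ W] nonneg_U_Cons nonneg_append[OF assms] V'(1)[of 1] by simp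
    have "?V \<in> {1..Suc k + 1} \<rightarrow>\<^sub>E {W. dyck_prefix W}"
    proof (intro PiE_I)
      fix i assume i: "i \<in> {1..Suc k + 1}"
      have "i - 1 \<in> {1..k + 1}" if "i \<noteq> 1" using i that by auto
      then show "?V i \<in> {W. dyck_prefix W}"
        using V'(1)[of "i - 1"] \<open>nonneg W\<close> i by (auto simp: dyck_prefix_iff_nonneg)
    next
      fix i assume i: "i \<notin> {1..Suc k + 1}"
      have "i - 1 \<notin> {1..k + 1}" if "i \<noteq> 0" using i that by auto
      then show "?V i = undefined" using V'(2)[of "i - 1"] i by auto
    qed
    moreover have "U # s i @ ?V (i + 1) \<preceq> ?V i" if "i \<in> {1..Suc k}" for i
    proof (cases "i = 1")
      case False
      then have "i - 1 \<in> {1..k}" using that by auto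
      then show ?thesis using that V'(4)[of "i - 1"] by auto
    qed (use W in simp)
    ultimately show "?V \<in> ?T" using V'(3) by (simp add: prefix_families_def)
  qed
  show "(\<lambda>V. (\<lambda>i. if i = 0 then undefined else V (Suc i), V 1)) ` ?T \<subseteq> ?S"
    by (auto simp: prefix_families_def dyck_prefix_iff_nonneg PiE_def Pi_def extensional_def)
qed

lemma finite_prefix_families:
  "(\<And>i. i \<in> {1..k} \<Longrightarrow> dyck (s i)) \<Longrightarrow> finite (prefix_families k s)"
proof (induction k arbitrary: s)
  case 0
  have "prefix_families 0 s \<subseteq> {\<lambda>i. if i = 1 then [] else undefined}"
    by (auto simp: prefix_families_def PiE_def extensional_def fun_eq_iff)
  then show ?case by (rule finite_subset) simp
next
  case (Suc k)
  have "finite (prefix_families k (s \<circ> Suc))" using Suc by simp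
  then show ?case
    using bij_betw_finite[OF bij_betw_prefix_families_Suc[of s k]] Suc.prems
    by (simp add: finite_above)
qed

lemma sum_prefix_families_Suc:
  fixes G :: "path \<Rightarrow> nat"
  assumes "\<And>i. i \<in> {1..Suc k} \<Longrightarrow> dyck (s i)"
  shows "(\<Sum>V\<in>prefix_families (Suc k) s. G (V 1)) =
    (\<Sum>V\<in>prefix_families k (s \<circ> Suc). \<Sum>W | U # s 1 @ V 1 \<preceq> W. G W)"
proof -
  have "(\<Sum>V\<in>prefix_families (Suc k) s. G (V 1)) =
      (\<Sum>(V, W)\<in>(SIGMA V:prefix_families k (s \<circ> Suc). {W. U # s 1 @ V 1 \<preceq> W}). G W)"
    using assms
    by (subst sum.reindex_bij_betw[OF bij_betw_prefix_families_Suc, symmetric])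
      (auto intro: sum.cong)
  also have "\<dots> = (\<Sum>V\<in>prefix_families k (s \<circ> Suc). \<Sum>W | U # s 1 @ V 1 \<preceq> W. G W)"
    using assms by (subst sum.Sigma) (auto simp: finite_above intro!: finite_prefix_families)
  finally show ?thesis .
qed

section \<open>Summation over all factors of the Dyck prefix\<close>

lemma sum_PiE_Suc:
  fixes H :: "(nat \<Rightarrow> 'a) \<Rightarrow> nat"
  assumes "\<And>i. i \<le> Suc k \<Longrightarrow> finite (A i)"
  shows "(\<Sum>s\<in>(\<Pi>\<^sub>E i\<in>{0..Suc k}. A i). H s) =
    (\<Sum>x\<in>A 0. \<Sum>s\<in>(\<Pi>\<^sub>E i\<in>{0..k}. A (Suc i)). H (case_nat x s))"
proof -
  have "bij_betw (\<lambda>(x, s). case_nat x s) (A 0 \<times> (\<Pi>\<^sub>E i\<in>{0..k}. A (Suc i)))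
      (\<Pi>\<^sub>E i\<in>{0..Suc k}. A i)"
    by (rule bij_betw_byWitness[where f' = "\<lambda>s. (s 0, s \<circ> Suc)"])
      (auto simp: PiE_def Pi_def extensional_def fun_eq_iff split: nat.split)
  then have "(\<Sum>s\<in>(\<Pi>\<^sub>E i\<in>{0..Suc k}. A i). H s) =
      (\<Sum>(x, s)\<in>A 0 \<times> (\<Pi>\<^sub>E i\<in>{0..k}. A (Suc i)). H (case_nat x s))"
    by (subst sum.reindex_bij_betw[symmetric]) (auto intro: sum.cong simp: case_prod_unfold)
  also have "\<dots> = (\<Sum>x\<in>A 0. \<Sum>s\<in>(\<Pi>\<^sub>E i\<in>{0..k}. A (Suc i)). H (case_nat x s))"
    by (simp add: sum.cartesian_product)
  finally show ?thesis .
qed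

lemma concat_U_Cons_Suc:
  fixes a :: "nat \<Rightarrow> path"
  shows "concat (map (\<lambda>i. U # a i) [1..<Suc k + 1]) =
    U # a 1 @ concat (map (\<lambda>i. U # a (Suc i)) [1..<k + 1])"
proof -
  have "[1..<Suc k + 1] = 1 # map Suc [1..<k + 1]"
    by (simp add: upt_conv_Cons map_Suc_upt del: upt_Suc)
  then show ?thesis by (simp add: comp_def del: upt_Suc)
qed

lemma nonneg_concat:
  "(\<And>i. i \<le> k \<Longrightarrow> dyck (a i)) \<Longrightarrow> nonneg (a 0 @ concat (map (\<lambda>i. U # a i) [1..<k + 1]))"
proof (induction k arbitrary: a)
  case 0
  then show ?case by (simp add: dyck_def nonneg_def)
next
  case (Suc k)
  have IH: "nonneg (a 1 @ concat (map (\<lambda>i. U # a (Suc i)) [1..<k + 1]))"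
    using Suc.IH[of "a \<circ> Suc"] Suc.prems by (simp add: comp_def del: upt_Suc)
  show ?case
    unfolding concat_U_Cons_Suc by (rule nonneg_append[OF Suc.prems nonneg_U_Cons[OF IH]]) simp
qed

text \<open>The weight must be arbitrary for the induction: splitting off \<open>a 0\<close>
  replaces \<open>F\<close> by a sum of its values, which is again a function of the first member of
  the shorter sequence.\<close>

lemma sum_pinned_chains:
  fixes F :: "path \<Rightarrow> nat"
  assumes "\<And>i. i \<le> k \<Longrightarrow> dyck (a i)"
  shows "(\<Sum>c\<in>pinned_chains 0 (a 0 @ concat (map (\<lambda>i. U # a i) [1..<k + 1])). F (c 0)) =
    (\<Sum>s\<in>(\<Pi>\<^sub>E i\<in>{0..k}. dyck_above (a i)). \<Sum>V\<in>prefix_families k s.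
      (\<Prod>i\<in>{0..k}. num_v (a i) (s i)) * F (s 0 @ V 1))"
  using assms
proof (induction k arbitrary: a F)
  case 0
  have V: "prefix_families 0 s = {\<lambda>i. if i = 1 then [] else undefined}" for s
  proof -
    have "nonneg []" by (simp add: nonneg_def)
    then show ?thesis
      by (auto simp: prefix_families_def PiE_def extensional_def fun_eq_iff dyck_prefix_iff_nonneg)
  qed
  have bij: "bij_betw (\<lambda>t i. if i = 0 then t else undefined) (dyck_above (a 0))
      (\<Pi>\<^sub>E i\<in>{0..0}. dyck_above (a i))"
    by (rule bij_betw_byWitness[where f' = "\<lambda>s. s 0"])
      (auto simp: PiE_def extensional_def fun_eq_iff)
  have "(\<Sum>s\<in>(\<Pi>\<^sub>E i\<in>{0..0}. dyck_above (a i)). num_v (a 0) (s 0) * F (s 0)) =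
      (\<Sum>t\<in>dyck_above (a 0). num_v (a 0) t * F t)"
    using sum.reindex_bij_betw[OF bij, of "\<lambda>s. num_v (a 0) (s 0) * F (s 0)"] by simp
  then show ?case using sum_num_v[of "a 0" F] 0 by (simp add: V)
next
  case (Suc k)
  define P where "P = a 1 @ concat (map (\<lambda>i. U # a (Suc i)) [1..<k + 1])"
  \<comment> \<open>\<open>t\<close> stands for \<open>s 0\<close> and \<open>W\<close> for the
    first Dyck prefix; \<open>R\<close> will be the first member of a sequence for
    \<open>P\<close>.\<close>
  define F' where "F' t R = (\<Sum>W | U # R \<preceq> W. F (t @ W))" for t R
  have P: "nonneg P"
    using nonneg_concat[of k "a \<circ> Suc"] Suc.prems by (simp add: P_def comp_def del: upt_Suc)
  let ?S = "\<Pi>\<^sub>E i\<in>{0..k}. dyck_above (a (Suc i))"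
  let ?v = "\<lambda>s. \<Prod>i\<in>{0..k}. num_v (a (Suc i)) (s i)"
  have fin: "finite (dyck_above t)" for t
    by (rule finite_subset[OF _ finite_paths]) auto
  have "(\<Sum>c\<in>pinned_chains 0 (a 0 @ concat (map (\<lambda>i. U # a i) [1..<Suc k + 1])). F (c 0)) =
      (\<Sum>x\<in>pinned_chains 0 (a 0). \<Sum>c\<in>pinned_chains 0 P. F' (x 0) (c 0))"
    using sum_pinned_chains_append[OF _ P, of "a 0" F] Suc.prems
    unfolding concat_U_Cons_Suc P_def[symmetric] F'_def by simp
  also have "\<dots> = (\<Sum>t\<in>dyck_above (a 0). num_v (a 0) t * (\<Sum>c\<in>pinned_chains 0 P. F' t (c 0)))"
    by (rule sum_num_v) (use Suc.prems in simp)
  also have "\<dots> = (\<Sum>t\<in>dyck_above (a 0). num_v (a 0) t *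
      (\<Sum>s\<in>?S. \<Sum>V\<in>prefix_families k s. ?v s * F' t (s 0 @ V 1)))"
    using Suc.IH[of "a \<circ> Suc"] Suc.prems by (simp add: P_def comp_def del: upt_Suc)
  also have "\<dots> = (\<Sum>t\<in>dyck_above (a 0). \<Sum>s\<in>?S. num_v (a 0) t * ?v s *
      (\<Sum>V\<in>prefix_families k s. F' t (s 0 @ V 1)))"
    by (simp add: sum_distrib_left mult.assoc)
  \<comment> \<open>The sum over \<open>W\<close> hidden in \<open>F'\<close> becomes the choice of
    \<open>V 1\<close> in a family that is longer by one.\<close>
  also have "\<dots> = (\<Sum>t\<in>dyck_above (a 0). \<Sum>s\<in>?S. \<Sum>V\<in>prefix_families (Suc k) (case_nat t s).
      (\<Prod>i\<in>{0..Suc k}. num_v (a i) (case_nat t s i)) * F (case_nat t s 0 @ V 1))"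
  proof (intro sum.cong refl)
    fix t s assume t: "t \<in> dyck_above (a 0)" and s: "s \<in> ?S"
    have "(\<Sum>V\<in>prefix_families k s. F' t (s 0 @ V 1)) =
        (\<Sum>V\<in>prefix_families (Suc k) (case_nat t s). F (t @ V 1))"
    proof -
      have "dyck (case_nat t s i)" if "i \<in> {1..Suc k}" for i
        using s that by (cases i) (auto simp: PiE_def Pi_def)
      moreover have "case_nat t s \<circ> Suc = s" by (simp add: fun_eq_iff)
      ultimately show ?thesis
        using sum_prefix_families_Suc[of k "case_nat t s" "\<lambda>W. F (t @ W)"] by (simp add: F'_def)
    qed
    moreover have "(\<Prod>i\<in>{0..Suc k}. num_v (a i) (case_nat t s i)) = num_v (a 0) t * ?v s"
      by (subst prod.atLeast0_atMost_Suc_shift) simp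
    ultimately show "num_v (a 0) t * ?v s * (\<Sum>V\<in>prefix_families k s. F' t (s 0 @ V 1)) =
        (\<Sum>V\<in>prefix_families (Suc k) (case_nat t s).
          (\<Prod>i\<in>{0..Suc k}. num_v (a i) (case_nat t s i)) * F (case_nat t s 0 @ V 1))"
      by (simp add: sum_distrib_left)
  qed
  also have "\<dots> = (\<Sum>s\<in>(\<Pi>\<^sub>E i\<in>{0..Suc k}. dyck_above (a i)). \<Sum>V\<in>prefix_families (Suc k) s.
      (\<Prod>i\<in>{0..Suc k}. num_v (a i) (s i)) * F (s 0 @ V 1))"
    by (rule sum_PiE_Suc[symmetric]) (rule fin)
  finally show ?case .
qed

section \<open>The weight \<open>J\<close> and the conclusion\<close>

lemma J_eq: "J P = card {Q. P \<preceq> Q}"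
proof -
  have "Q \<preceq> path_top (length P)" if "P \<preceq> Q" for Q
    using path_le_top[of Q] path_le_length[OF that] by simp
  then show ?thesis unfolding J_def path_interval_def by (metis (no_types, lifting))
qed

text \<open>Dropping the first member raises the level from -1 to 0. At level -1 the nonnegative
  path \<open>P\<close> pins nothing, so the dropped member is any path above
  \<open>c 0\<close>.\<close>

lemma card_pinned_chains_minus_one:
  assumes P: "nonneg P"
  shows "card (pinned_chains (- 1) P) = (\<Sum>c\<in>pinned_chains 0 P. J (c 0))"
proof -
  have "bij_betw (\<lambda>(c, Q). case_nat Q c) (SIGMA c:pinned_chains 0 P. {Q. c 0 \<preceq> Q})
      (pinned_chains (- 1) P)" (is "bij_betw _ ?S ?T")
  proof (rule bij_betw_byWitness[where f' = "\<lambda>q. (q \<circ> Suc, q 0)"])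
    show "(\<lambda>(c, Q). case_nat Q c) ` ?S \<subseteq> ?T"
    proof (rule image_subsetI, clarify)
      fix c Q assume c: "c \<in> pinned_chains 0 P" and Q: "c 0 \<preceq> Q"
      have "P \<preceq> Q" using path_le_trans[OF _ Q] c by (auto simp: pinned_chains_def)
      then show "case_nat Q c \<in> ?T"
        using c Q pinned_below_zero[OF P, of "- 1"]
        by (auto simp: pinned_chains_def split: nat.split)
    qed
    show "(\<lambda>q. (q \<circ> Suc, q 0)) ` ?T \<subseteq> ?S"
    proof (rule image_subsetI)
      fix q assume q: "q \<in> ?T"
      have "pinned (int i) P (q (Suc i))" for i
      proof -
        have "pinned (- 1 + int (Suc i)) P (q (Suc i))"
          using q unfolding pinned_chains_def by blast
        then show ?thesis by simp
      qed
      then show "(q \<circ> Suc, q 0) \<in> ?S" using q by (auto simp: pinned_chains_def)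
    qed
  qed (auto simp: fun_eq_iff split: nat.split)
  then have "card (pinned_chains (- 1) P) = card (SIGMA c:pinned_chains 0 P. {Q. c 0 \<preceq> Q})"
    by (rule bij_betw_same_card[symmetric])
  also have "\<dots> = (\<Sum>c\<in>pinned_chains 0 P. J (c 0))"
    by (simp add: J_eq finite_pinned_chains finite_above)
  finally show ?thesis .
qed

theorem proposition17:
  fixes P :: path and k :: nat and a :: "nat \<Rightarrow> path"
  assumes "dyck_prefix P"
    and "\<And>i. i \<le> k \<Longrightarrow> dyck (a i)"
    and "P = a 0 @ concat (map (\<lambda>i. U # a i) [1..<k + 1])"
  shows "num_small_chains (D # U # P) =
    (\<Sum>s \<in> (\<Pi>\<^sub>E i\<in>{0..k}. {t. dyck t \<and> length t = length (a i) \<and> a i \<preceq> t}).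
     \<Sum>V \<in> {V \<in> {1..k + 1} \<rightarrow>\<^sub>E {W. dyck_prefix W}.
             V (k + 1) = [] \<and> (\<forall>i\<in>{1..k}. U # s i @ V (i + 1) \<preceq> V i)}.
       (\<Prod>i\<in>{0..k}. num_v (a i) (s i)) * J (s 0 @ V 1))"
proof -
  have P: "nonneg P" using assms(1) by (simp add: dyck_prefix_iff_nonneg)
  have "num_small_chains (D # U # P) = (\<Sum>c\<in>pinned_chains 0 P. J (c 0))"
    using P by (simp add: num_small_chains_DU card_pinned_chains_minus_one)
  then show ?thesis
    using sum_pinned_chains[of k a J] assms(2)
    unfolding assms(3)[symmetric] prefix_families_def by simp
qed

end
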